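(* For each $n\ge 1$, $\mathbf{Grz}[n]\times\mathbf{S5}=\mathbf{M}^+\mathbf{GrzB}[n]$.
   Context: $\mathcal{L}_{\Diamond\exists}$ is the propositional language with two modalities $\Diamond,\exists$, with $\Box=\neg\Diamond\neg$ and $\forall=\neg\exists\neg$. $\mathbf{Grz}=\mathbf{K}+\Box(\Box(p\to\Box p)\to p)\to p$ (in modality $\Diamond$), whose frames are partial orders without infinite ascending chains; $\mathbf{S5}$ is formulated in modality $\exists$. The fusion $\mathbf{Grz}\otimes\mathbf{S5}$ is the least set of $\mathcal{L}_{\Diamond\exists}$-formulae containing the theorems of both logics and closed under Modus Ponens, Substitution, $\Box$-necessitation, and $\forall$-necessitation; "$+$" denotes the least extension containing the given formulae and closed under the applicable rules among these. Put $$\mathbf{MGrzB}=(\mathbf{Grz}\otimes\mathbf{S5})+(\exists\Diamond p\to\Diamond\exists p)+(\Diamond\exists p\to\exists\Diamond p),$$ $$\mathbf{M}^+\mathbf{GrzB}=\mathbf{MGrzB}+\Box\forall(\Box(\Box p\to\Box\forall p)\to\Box\forall p)\to\Box\forall p.$$ The finite depth formulae are $bd_1=\Diamond\Box p_1\to p_1$ and $bd_n=\Diamond(\Box p_n\wedge\neg bd_{n-1})\to p_n$ for $n\ge2$. For any logic $\mathbf{L}$, $\mathbf{L}[n]=\mathbf{L}+bd_n$; thus $\mathbf{Grz}[n]=\mathbf{Grz}+bd_n$ is a unimodal logic (the logic of $\mathbf{Grz}$-frames of depth at most $n$) and $\mathbf{M}^+\mathbf{GrzB}[n]=\mathbf{M}^+\mathbf{GrzB}+bd_n$.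 For Kripke frames $\mathfrak{F}=(X_1,R_1)$ and $\mathfrak{G}=(X_2,R_2)$ with $R_2$ an equivalence relation, the product frame is $\mathfrak{F}\times\mathfrak{G}=(X_1\times X_2,R,E)$, where $(x,u)R(y,v)$ iff $xR_1y$ and $u=v$, and $(x,u)E(y,v)$ iff $x=y$ and $uR_2v$; $R$ interprets $\Diamond$ and $E$ interprets $\exists$. For a Kripke complete unimodal logic $\mathbf{L}$, $\mathbf{L}\times\mathbf{S5}$ is the set of all $\mathcal{L}_{\Diamond\exists}$-formulae valid in all product frames $\mathfrak{F}\times\mathfrak{G}$ with $\mathfrak{F}$ an $\mathbf{L}$-frame and $\mathfrak{G}$ an $\mathbf{S5}$-frame (a set with an equivalence relation). *)

theory Defs
  imports Main
begin

section \<open>Modal formulae\<close>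

text \<open>
  Formulae are parametrised by the type \<open>'m\<close> of modality indices: \<open>unit\<close> gives the unimodal
  language, \<open>modality\<close> the bimodal one. The primitive modal operators are the diamonds.
\<close>

datatype 'm fm =
    Var nat
  | Fls
  | Imp "'m fm" "'m fm"  (infixr "\<^bold>\<rightarrow>" 55)
  | Dia 'm "'m fm"

abbreviation Neg :: "'m fm \<Rightarrow> 'm fm"  ("\<^bold>\<not> _" [70] 70)
  where "\<^bold>\<not> \<phi> \<equiv> \<phi> \<^bold>\<rightarrow> Fls"

abbreviation Conj :: "'m fm \<Rightarrow> 'm fm \<Rightarrow> 'm fm"  (infixr "\<^bold>\<and>" 60)
  where "\<phi> \<^bold>\<and> \<psi> \<equiv> \<^bold>\<not> (\<phi> \<^bold>\<rightarrow> \<^bold>\<not> \<psi>)"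

abbreviation Box :: "'m \<Rightarrow> 'm fm \<Rightarrow> 'm fm"
  where "Box m \<phi> \<equiv> \<^bold>\<not> (Dia m (\<^bold>\<not> \<phi>))"

datatype modality = DiaM | ExM

abbreviation bdia :: "modality fm \<Rightarrow> modality fm"  ("\<^bold>\<diamond> _" [70] 70)
  where "\<^bold>\<diamond> \<phi> \<equiv> Dia DiaM \<phi>"

abbreviation bbox :: "modality fm \<Rightarrow> modality fm"  ("\<^bold>\<box> _" [70] 70)
  where "\<^bold>\<box> \<phi> \<equiv> Box DiaM \<phi>"

abbreviation bex :: "modality fm \<Rightarrow> modality fm"  ("\<^bold>\<exists> _" [70] 70)
  where "\<^bold>\<exists> \<phi> \<equiv> Dia ExM \<phi>"

abbreviation ball :: "modality fm \<Rightarrow> modality fm"  ("\<^bold>\<forall> _" [70] 70)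
  where "\<^bold>\<forall> \<phi> \<equiv> Box ExM \<phi>"

primrec subst :: "(nat \<Rightarrow> 'm fm) \<Rightarrow> 'm fm \<Rightarrow> 'm fm" where
  "subst \<sigma> (Var i) = \<sigma> i"
| "subst \<sigma> Fls = Fls"
| "subst \<sigma> (\<phi> \<^bold>\<rightarrow> \<psi>) = subst \<sigma> \<phi> \<^bold>\<rightarrow> subst \<sigma> \<psi>"
| "subst \<sigma> (Dia m \<phi>) = Dia m (subst \<sigma> \<phi>)"


section \<open>Axiomatic extensions and the logics\<close>

text \<open>\<open>e\<close> decides the subformulae that are propositionally atomic, i.e. variables and diamonds.\<close>

primrec prop_eval :: "('m fm \<Rightarrow> bool) \<Rightarrow> 'm fm \<Rightarrow> bool" where
  "prop_eval e (Var i) \<longleftrightarrow> e (Var i)"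
| "prop_eval e Fls \<longleftrightarrow> False"
| "prop_eval e (\<phi> \<^bold>\<rightarrow> \<psi>) \<longleftrightarrow> (prop_eval e \<phi> \<longrightarrow> prop_eval e \<psi>)"
| "prop_eval e (Dia m \<phi>) \<longleftrightarrow> e (Dia m \<phi>)"

definition tautologies :: "'m fm set" where
  "tautologies = {\<phi>. \<forall>e. prop_eval e \<phi>}"

inductive_set extension :: "'m fm set \<Rightarrow> 'm fm set \<Rightarrow> 'm fm set"  (infixl "\<oplus>" 65)
  for L \<Gamma> :: "'m fm set" where
  base: "\<phi> \<in> L \<Longrightarrow> \<phi> \<in> L \<oplus> \<Gamma>"
| ax:   "\<phi> \<in> \<Gamma> \<Longrightarrow> \<phi> \<in> L \<oplus> \<Gamma>"
| mp:   "\<phi> \<^bold>\<rightarrow> \<psi> \<in> L \<oplus> \<Gamma> \<Longrightarrow> \<phi> \<in> L \<oplus> \<Gamma> \<Longrightarrow> \<psi> \<in> L \<oplus> \<Gamma>"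
| sub:  "\<phi> \<in> L \<oplus> \<Gamma> \<Longrightarrow> subst \<sigma> \<phi> \<in> L \<oplus> \<Gamma>"
| nec:  "\<phi> \<in> L \<oplus> \<Gamma> \<Longrightarrow> Box m \<phi> \<in> L \<oplus> \<Gamma>"

text \<open>
  Since the diamond is primitive and the box an abbreviation, the duality between
  \<open>\<diamond>p\<close> and \<open>\<not>\<box>\<not>p\<close> has to be postulated: it is not derivable from the distribution axiom.
\<close>

definition K :: "unit fm set" where
  "K = tautologies \<oplus>
     {Box () (Var 0 \<^bold>\<rightarrow> Var 1) \<^bold>\<rightarrow> Box () (Var 0) \<^bold>\<rightarrow> Box () (Var 1),
      Dia () (Var 0) \<^bold>\<rightarrow> \<^bold>\<not> (Box () (\<^bold>\<not> (Var 0))),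
      \<^bold>\<not> (Box () (\<^bold>\<not> (Var 0))) \<^bold>\<rightarrow> Dia () (Var 0)}"

definition Grz :: "unit fm set" where
  "Grz = K \<oplus> {Box () (Box () (Var 0 \<^bold>\<rightarrow> Box () (Var 0)) \<^bold>\<rightarrow> Var 0) \<^bold>\<rightarrow> Var 0}"

definition S5 :: "unit fm set" where
  "S5 = K \<oplus>
     {Var 0 \<^bold>\<rightarrow> Dia () (Var 0),
      Dia () (Dia () (Var 0)) \<^bold>\<rightarrow> Dia () (Var 0),
      Var 0 \<^bold>\<rightarrow> Box () (Dia () (Var 0))}"

definition fusion :: "unit fm set \<Rightarrow> unit fm set \<Rightarrow> modality fm set" where
  "fusion L1 L2 = (map_fm (\<lambda>_. DiaM) ` L1) \<oplus> (map_fm (\<lambda>_. ExM) ` L2)"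

definition MGrzB :: "modality fm set" where
  "MGrzB = fusion Grz S5 \<oplus> {\<^bold>\<exists> \<^bold>\<diamond> (Var 0) \<^bold>\<rightarrow> \<^bold>\<diamond> \<^bold>\<exists> (Var 0)} \<oplus> {\<^bold>\<diamond> \<^bold>\<exists> (Var 0) \<^bold>\<rightarrow> \<^bold>\<exists> \<^bold>\<diamond> (Var 0)}"

definition MplusGrzB :: "modality fm set" where
  "MplusGrzB = MGrzB \<oplus>
     {\<^bold>\<box> \<^bold>\<forall> (\<^bold>\<box> (\<^bold>\<box> (Var 0) \<^bold>\<rightarrow> \<^bold>\<box> \<^bold>\<forall> (Var 0)) \<^bold>\<rightarrow> \<^bold>\<box> \<^bold>\<forall> (Var 0)) \<^bold>\<rightarrow> \<^bold>\<box> \<^bold>\<forall> (Var 0)}"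

text \<open>Only \<open>n \<ge> 1\<close> is meaningful; the value at \<open>0\<close> is a dummy and is not used by the other clauses.\<close>

fun bd :: "'m \<Rightarrow> nat \<Rightarrow> 'm fm" where
  "bd m 0 = Fls"
| "bd m (Suc 0) = Dia m (Box m (Var 1)) \<^bold>\<rightarrow> Var 1"
| "bd m (Suc (Suc n)) =
     Dia m (Box m (Var (Suc (Suc n))) \<^bold>\<and> \<^bold>\<not> (bd m (Suc n))) \<^bold>\<rightarrow> Var (Suc (Suc n))"

definition Grz_depth :: "nat \<Rightarrow> unit fm set" where
  "Grz_depth n = Grz \<oplus> {bd () n}"

definition MplusGrzB_depth :: "nat \<Rightarrow> modality fm set" where
  "MplusGrzB_depth n = MplusGrzB \<oplus> {bd DiaM n}"


section \<open>Kripke semantics and products\<close>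

record ('w, 'm) frame =
  worlds :: "'w set"
  acc :: "'m \<Rightarrow> 'w rel"

definition is_frame :: "('w, 'm) frame \<Rightarrow> bool" where
  "is_frame F \<longleftrightarrow> worlds F \<noteq> {} \<and> (\<forall>m. acc F m \<subseteq> worlds F \<times> worlds F)"

primrec sat :: "('w, 'm) frame \<Rightarrow> (nat \<Rightarrow> 'w set) \<Rightarrow> 'w \<Rightarrow> 'm fm \<Rightarrow> bool" where
  "sat F V x (Var i) \<longleftrightarrow> x \<in> V i"
| "sat F V x Fls \<longleftrightarrow> False"
| "sat F V x (\<phi> \<^bold>\<rightarrow> \<psi>) \<longleftrightarrow> (sat F V x \<phi> \<longrightarrow> sat F V x \<psi>)"
| "sat F V x (Dia m \<phi>) \<longleftrightarrow> (\<exists>y\<in>worlds F. (x, y) \<in> acc F m \<and> sat F V y \<phi>)"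

definition valid :: "('w, 'm) frame \<Rightarrow> 'm fm \<Rightarrow> bool" where
  "valid F \<phi> \<longleftrightarrow> (\<forall>V. \<forall>x\<in>worlds F. sat F V x \<phi>)"

definition logic_frame :: "'m fm set \<Rightarrow> ('w, 'm) frame \<Rightarrow> bool" where
  "logic_frame L F \<longleftrightarrow> is_frame F \<and> (\<forall>\<phi>\<in>L. valid F \<phi>)"

definition S5_frame :: "('w, unit) frame \<Rightarrow> bool" where
  "S5_frame G \<longleftrightarrow> is_frame G \<and> equiv (worlds G) (acc G ())"

definition product_frame ::
  "('a, unit) frame \<Rightarrow> ('b, unit) frame \<Rightarrow> ('a \<times> 'b, modality) frame" where
  "product_frame F G =
     \<lparr>worlds = worlds F \<times> worlds G,
      acc = (\<lambda>m. case m of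
         DiaM \<Rightarrow> {((x, u), (y, v)). (x, y) \<in> acc F () \<and> u = v \<and> u \<in> worlds G}
       | ExM \<Rightarrow> {((x, u), (y, v)). x = y \<and> x \<in> worlds F \<and> (u, v) \<in> acc G ()})\<rparr>"

text \<open>
  HOL cannot quantify over all types, so the types \<open>'a\<close> and \<open>'b\<close>, from which the worlds of the
  two factors are drawn, are parameters. The carriers are arbitrary nonempty subsets of these
  types, so frames of any cardinality up to that of the types are covered.
  For infinite types this loses nothing whenever the \<open>L\<close>-frames form an elementary class: by
  Loewenheim-Skolem a formula refuted on some product frame is refuted on one with countable factors.
\<close>

definition product_S5 :: "'a itself \<Rightarrow> 'b itself \<Rightarrow> unit fm set \<Rightarrow> modality fm set" where
  "product_S5 _ _ L =
     {\<phi>. \<forall>(F :: ('a, unit) frame) (G :: ('b, unit) frame).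
           logic_frame L F \<longrightarrow> S5_frame G \<longrightarrow> valid (product_frame F G) \<phi>}"

end

theory Submission
  imports Defs "HOL-Library.Countable_Set" "HOL-Library.Sublist"
begin

text \<open>
  Completeness goes through the canonical frame. There \<open>bd\<^sub>n\<close> bounds the length of strict
  \<open>R\<close>-chains, and a depth bound yields, for every cluster of \<open>R\<close> or of \<open>Q = R O E\<close>, a formula that
  fails on the cluster and holds strictly above it. Relativising the Grz axiom and Casari's axiom
  by such formulae shows that \<open>R\<close> is antisymmetric and trivial inside every \<open>Q\<close>-cluster
  (``cleanness''). A countable Skolem hull keeps
  these properties. It is then unravelled into a product: a point of the first factor is a tree
  node \<open>a\<close> carrying a map \<open>f\<^sub>a\<close> from \<open>nat\<close> onto an \<open>E\<close>-class with infinite fibres, and the children of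
  \<open>a\<close> move one chosen value \<open>f\<^sub>a w\<close> to a chosen \<open>y\<close> strictly \<open>R\<close>-above it, all other values following by the
  commutation of \<open>R\<close> and \<open>E\<close>. By cleanness every move is strict at all indices, so the depth of the
  tree is bounded by that of \<open>R\<close>.
\<close>

section \<open>Strict chains\<close>

text \<open>The index counts steps, not points: if \<open>strict_chain r n x\<close> fails, strict
  chains from \<open>x\<close> have at most \<open>n\<close> points, which is depth at most
  \<open>n\<close>.\<close>

primrec strict_chain :: "('w \<Rightarrow> 'w \<Rightarrow> bool) \<Rightarrow> nat \<Rightarrow> 'w \<Rightarrow> bool" where
  "strict_chain r 0 x \<longleftrightarrow> True"
| "strict_chain r (Suc k) x \<longleftrightarrow> (\<exists>y. r x y \<and> \<not> r y x \<and> strict_chain r k y)"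

text \<open>Otherwise every point of \<open>P\<close> above \<open>w\<close> has a strict successor
  in \<open>P\<close>, and these steps build chains of any length.\<close>

lemma maximal_above:
  assumes "transp r" "antisymp r" "\<not> strict_chain r n w" "r w w" "P w"
  shows "\<exists>m. r w m \<and> P m \<and> (\<forall>v. r m v \<longrightarrow> P v \<longrightarrow> v = m)"
proof (rule ccontr)
  assume "\<nexists>m. r w m \<and> P m \<and> (\<forall>v. r m v \<longrightarrow> P v \<longrightarrow> v = m)"
  then have next_point: "\<exists>v. r m v \<and> P v \<and> v \<noteq> m" if "r w m" "P m" for m
    using that by blast
  have "strict_chain r k v" if "r w v" "P v" for k v
    using that
  proof (induction k arbitrary: v)
    case (Suc k)
    then obtain u where "r v u" "P u" "u \<noteq> v"
      using next_point by blast
    moreover from this have "\<not> r u v" "r w u"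
      using assms(1,2) Suc.prems(1) by (auto dest: antisympD transpD)
    ultimately show ?case
      using Suc.IH by auto
  qed simp
  then show False
    using assms(3-5) by blast
qed


section \<open>Soundness\<close>

lemma sat_subst:
  "sat F V x (subst \<sigma> \<phi>) \<longleftrightarrow> sat F (\<lambda>i. {y. sat F V y (\<sigma> i)}) x \<phi>"
  by (induction \<phi> arbitrary: x) auto

lemma sat_tautology:
  assumes "\<phi> \<in> tautologies"
  shows "sat F V x \<phi>"
proof -
  \<comment> \<open>Truth at the fixed point \<open>x\<close> is itself one decision of variables
    and diamonds.\<close>
  have "sat F V x \<phi> \<longleftrightarrow> prop_eval (sat F V x) \<phi>"
    by (induction \<phi>) auto
  then show ?thesis
    using assms by (simp add: tautologies_def)
qed

lemma valid_extension:
  assumes "\<phi> \<in> L \<oplus> \<Gamma>" "\<And>\<psi>. \<psi> \<in> L \<Longrightarrow> valid F \<psi>" "\<And>\<psi>. \<psi> \<in> \<Gamma> \<Longrightarrow> valid F \<psi>"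
  shows "valid F \<phi>"
  using assms(1)
proof induction
  case (mp \<phi> \<psi>)
  then show ?case by (auto simp: valid_def)
next
  case (sub \<phi> \<sigma>)
  then show ?case by (auto simp: valid_def sat_subst)
next
  case (nec \<phi> m)
  then show ?case by (auto simp: valid_def)
qed (use assms(2,3) in auto)

lemma valid_K: "\<phi> \<in> K \<Longrightarrow> valid F \<phi>"
  unfolding K_def by (erule valid_extension) (auto simp: valid_def sat_tautology)

lemma valid_S5:
  assumes "S5_frame G" "\<phi> \<in> S5"
  shows "valid G \<phi>"
proof -
  have eq: "equiv (worlds G) (acc G ())"
    using assms(1) by (simp add: S5_frame_def)
  then have refl: "\<And>x. x \<in> worlds G \<Longrightarrow> (x, x) \<in> acc G ()"
    and sym: "\<And>x y. (x, y) \<in> acc G () \<Longrightarrow> (y, x) \<in> acc G ()"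
    and trans: "\<And>x y z. (x, y) \<in> acc G () \<Longrightarrow> (y, z) \<in> acc G () \<Longrightarrow> (x, z) \<in> acc G ()"
    by (auto simp: equiv_def refl_on_def dest: symD transD)
  have "valid G (Var 0 \<^bold>\<rightarrow> Dia () (Var 0))"
    using refl by (auto simp: valid_def)
  moreover have "valid G (Dia () (Dia () (Var 0)) \<^bold>\<rightarrow> Dia () (Var 0))"
    using trans by (fastforce simp: valid_def)
  moreover have "valid G (Var 0 \<^bold>\<rightarrow> Box () (Dia () (Var 0)))"
    using sym by (auto simp: valid_def)
  ultimately show ?thesis
    using assms(2) unfolding S5_def by (elim valid_extension) (auto simp: valid_K)
qed

text \<open>Where the formula fails, the topmost variable is false, yet it is boxed at some
  successor. That successor cannot see back, so the step is strict.\<close>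

lemma not_sat_bd:
  assumes "is_frame F" "k \<ge> 1" "x \<in> worlds F" "\<not> sat F V x (bd m k)"
  shows "strict_chain (\<lambda>x y. (x, y) \<in> acc F m) k x"
  using assms(2-)
proof (induction m k arbitrary: x rule: bd.induct)
  case (2 m)
  then show ?case by auto
next
  case (3 m k)
  then obtain y where "y \<in> worlds F" "(x, y) \<in> acc F m" "\<not> sat F V y (bd m (Suc k))" "x \<notin> V (Suc (Suc k))"
    "(y, x) \<notin> acc F m"
    by (auto simp del: bd.simps simp: bd.simps(3))
  then show ?case
    using 3 by (auto simp del: bd.simps)
qed simp

text \<open>Applied to the tree built at the end. The depth bound supplies the maximal points on
  which the Grz axiom rests.\<close>

lemma logic_frame_Grz_depthI:
  assumes F: "is_frame F" and order: "partial_order_on (worlds F) (acc F ())"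
    and "n \<ge> 1" and chain: "\<And>x. x \<in> worlds F \<Longrightarrow> \<not> strict_chain (\<lambda>x y. (x, y) \<in> acc F ()) n x"
  shows "logic_frame (Grz_depth n) F"
proof -
  let ?r = "\<lambda>x y. (x, y) \<in> acc F ()"
  have tr: "transp ?r" and as: "antisymp ?r" and rf: "\<And>x. x \<in> worlds F \<Longrightarrow> ?r x x"
    using order unfolding partial_order_on_def preorder_on_def
    by (auto simp: transp_def antisymp_def dest: transD antisymD refl_onD)
  have in_F: "\<And>x y. ?r x y \<Longrightarrow> x \<in> worlds F \<and> y \<in> worlds F"
    using F by (auto simp: is_frame_def)
  have grz: "sat F V x (Box () (Box () (Var 0 \<^bold>\<rightarrow> Box () (Var 0)) \<^bold>\<rightarrow> Var 0) \<^bold>\<rightarrow> Var 0)"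
    if x: "x \<in> worlds F" for V x
  proof (rule ccontr)
    assume *: "\<not> ?thesis"
    then have "x \<notin> V 0" by simp
    obtain m where m: "?r x m" "m \<notin> V 0" "\<And>v. ?r m v \<Longrightarrow> v \<notin> V 0 \<Longrightarrow> v = m"
      using maximal_above[OF tr as chain[OF x] rf[OF x], of "\<lambda>v. v \<notin> V 0"] \<open>x \<notin> V 0\<close> by blast
    \<comment> \<open>\<open>Var 0\<close> fails at \<open>m\<close>, so
      \<open>\<box>(p \<rightarrow> \<box>p)\<close> fails there too; by maximality the failure at
      \<open>u\<close> lies at \<open>m\<close> itself, which puts \<open>v\<close> strictly between
      \<open>m\<close> and \<open>m\<close>.\<close>
    with * in_F obtain v u where "?r m v" "v \<in> V 0" "?r v u" "u \<notin> V 0"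
      by auto
    moreover from this have "u = m"
      using m(3) transpD[OF tr] by blast
    ultimately show False
      using m(2) antisympD[OF as] by blast
  qed
  then have "valid F (Box () (Box () (Var 0 \<^bold>\<rightarrow> Box () (Var 0)) \<^bold>\<rightarrow> Var 0) \<^bold>\<rightarrow> Var 0)"
    unfolding valid_def by blast
  then have "valid F \<phi>" if "\<phi> \<in> Grz" for \<phi>
    using that valid_extension[of \<phi> K _ F] valid_K unfolding Grz_def by blast
  moreover have "valid F (bd () n)"
    using not_sat_bd[OF F \<open>n \<ge> 1\<close>] chain unfolding valid_def by blast
  ultimately show ?thesis
    using F valid_extension[of _ Grz "{bd () n}" F] unfolding logic_frame_def Grz_depth_def by blast
qed

text \<open>A violation of any of the three properties refutes the Grz axiom at \<open>x\<close>
  when the variable is false exactly at \<open>x\<close>, or, for transitivity, exactly at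
  \<open>x\<close> and \<open>z\<close>: no successor of \<open>x\<close> other than
  \<open>x\<close> falsifies it.\<close>

lemma Grz_frame_order:
  fixes F :: "('w, unit) frame"
  assumes "logic_frame Grz F"
  shows "partial_order_on (worlds F) (acc F ())"
proof -
  have F: "is_frame F"
    using assms by (simp add: logic_frame_def)
  then have in_F: "\<And>x y. (x, y) \<in> acc F () \<Longrightarrow> x \<in> worlds F \<and> y \<in> worlds F"
    by (auto simp: is_frame_def)
  have "Box () (Box () (Var 0 \<^bold>\<rightarrow> Box () (Var 0)) \<^bold>\<rightarrow> Var 0) \<^bold>\<rightarrow> Var 0 \<in> Grz"
    unfolding Grz_def by (rule extension.ax) simp
  then have grz: "sat F (\<lambda>_. A) x (Box () (Box () (Var 0 \<^bold>\<rightarrow> Box () (Var 0)) \<^bold>\<rightarrow> Var 0) \<^bold>\<rightarrow> Var 0)"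
    if "x \<in> worlds F" for A x
    using assms that by (auto simp only: logic_frame_def valid_def)
  have "refl_on (worlds F) (acc F ())"
  proof (rule refl_onI)
    fix x assume "x \<in> worlds F"
    then show "(x, x) \<in> acc F ()"
      using grz[of x "- {x}"] by auto
  qed
  moreover have "trans (acc F ())"
  proof (rule transI, rule ccontr)
    fix x y z assume "(x, y) \<in> acc F ()" "(y, z) \<in> acc F ()" "(x, z) \<notin> acc F ()"
    then show False
      using grz[of x "- {x, z}"] in_F by auto
  qed
  moreover have "antisym (acc F ())"
  proof (rule antisymI, rule ccontr)
    fix x y assume "(x, y) \<in> acc F ()" "(y, x) \<in> acc F ()" "x \<noteq> y"
    then show False
      using grz[of x "- {x}"] in_F by auto
  qed
  ultimately show ?thesis
    using in_F by (auto simp: partial_order_on_def preorder_on_def)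
qed

text \<open>An ascending chain would be refuted by making \<open>p\<close> false exactly at its even members.\<close>

lemma Grz_frame_maximal:
  fixes F :: "('w, unit) frame"
  assumes "logic_frame Grz F" "S \<subseteq> worlds F" "S \<noteq> {}"
  obtains m where "m \<in> S" "\<And>v. (m, v) \<in> acc F () \<Longrightarrow> v \<in> S \<Longrightarrow> v = m"
proof (rule ccontr)
  assume "\<not> thesis"
  then have "\<forall>m\<in>S. \<exists>v. (m, v) \<in> acc F () \<and> v \<in> S \<and> v \<noteq> m"
    using that by blast
  then obtain g where g: "\<And>m. m \<in> S \<Longrightarrow> (m, g m) \<in> acc F () \<and> g m \<in> S \<and> g m \<noteq> m"
    by metis
  obtain s where "s \<in> S" using assms(3) by blast
  define c where "c k = (g ^^ k) s" for k
  have cS: "c k \<in> S" for k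
    by (induction k) (use \<open>s \<in> S\<close> g in \<open>auto simp: c_def\<close>)
  have step: "(c k, c (Suc k)) \<in> acc F () \<and> c (Suc k) \<noteq> c k" for k
    using g[OF cS[of k]] by (simp add: c_def)
  have tr: "trans (acc F ())" and as: "antisym (acc F ())" and rf: "refl_on (worlds F) (acc F ())"
    using Grz_frame_order[OF assms(1)] by (auto simp: partial_order_on_def preorder_on_def)
  have up: "(c j, c (j + k)) \<in> acc F ()" for j k
  proof (induction k)
    case 0
    then show ?case using refl_onD[OF rf] cS assms(2) by auto
  next
    case (Suc k)
    then show ?case using step[of "j + k"] transD[OF tr] by auto
  qed
  have "c (j + Suc k) \<noteq> c j" for j k
    using step[of j] up[of "Suc j" k] antisymD[OF as, of "c j" "c (Suc j)"] by auto
  then have inj: "c j = c k \<Longrightarrow> j = k" for j k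
    by (metis add_Suc_right less_imp_Suc_add linorder_neqE_nat)
  have "Box () (Box () (Var 0 \<^bold>\<rightarrow> Box () (Var 0)) \<^bold>\<rightarrow> Var 0) \<^bold>\<rightarrow> Var 0 \<in> Grz"
    unfolding Grz_def by (rule extension.ax) simp
  then have "sat F (\<lambda>_. - range (\<lambda>k. c (2 * k))) (c 0)
      (Box () (Box () (Var 0 \<^bold>\<rightarrow> Box () (Var 0)) \<^bold>\<rightarrow> Var 0) \<^bold>\<rightarrow> Var 0)"
    using assms(1,2) cS[of 0] by (auto simp only: logic_frame_def valid_def)
  moreover have "c 0 \<in> range (\<lambda>k. c (2 * k))"
    by (metis mult_0_right rangeI)
  ultimately obtain w where w: "w \<in> range (\<lambda>k. c (2 * k))" and no: "\<And>v u. v \<in> worlds F \<Longrightarrow>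
      (w, v) \<in> acc F () \<Longrightarrow> v \<notin> range (\<lambda>k. c (2 * k)) \<Longrightarrow> u \<in> worlds F \<Longrightarrow> (v, u) \<in> acc F () \<Longrightarrow>
      u \<notin> range (\<lambda>k. c (2 * k))"
    by (simp del: image_iff) blast
  then obtain k where w: "w = c (2 * k)"
    by blast
  have "c (Suc (2 * k)) \<notin> range (\<lambda>k. c (2 * k))"
    using inj by (metis (no_types) rangeE dvd_triv_left even_Suc)
  moreover have "c (Suc (Suc (2 * k))) \<in> range (\<lambda>k. c (2 * k))"
    by (rule range_eqI[of _ _ "Suc k"]) simp
  ultimately show False
    using no[of "c (Suc (2 * k))" "c (Suc (Suc (2 * k)))"] step cS assms(2) unfolding w by blast
qed

section \<open>Validity in product frames\<close>

lemma worlds_product_frame [simp]: "worlds (product_frame F G) = worlds F \<times> worlds G"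
  by (simp add: product_frame_def)

lemma acc_product_frame [simp]:
  "((x, u), (y, v)) \<in> acc (product_frame F G) DiaM \<longleftrightarrow> (x, y) \<in> acc F () \<and> u = v \<and> u \<in> worlds G"
  "((x, u), (y, v)) \<in> acc (product_frame F G) ExM \<longleftrightarrow> x = y \<and> x \<in> worlds F \<and> (u, v) \<in> acc G ()"
  by (auto simp: product_frame_def)

text \<open>The \<open>DiaM\<close>-relation fixes the second coordinate, so evaluation stays in the
  copy of \<open>F\<close> at \<open>u\<close>.\<close>

lemma sat_product_DiaM:
  assumes "x \<in> worlds F" "u \<in> worlds G"
  shows "sat (product_frame F G) V (x, u) (map_fm (\<lambda>_. DiaM) \<phi>) \<longleftrightarrow> sat F (\<lambda>i. {y. (y, u) \<in> V i}) x \<phi>"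
  using assms by (induction \<phi> arbitrary: x) auto

lemma sat_product_ExM:
  assumes "x \<in> worlds F" "u \<in> worlds G"
  shows "sat (product_frame F G) V (x, u) (map_fm (\<lambda>_. ExM) \<phi>) \<longleftrightarrow> sat G (\<lambda>i. {v. (x, v) \<in> V i}) u \<phi>"
  using assms by (induction \<phi> arbitrary: u) auto

lemma map_fm_bd: "map_fm f (bd m k) = bd (f m) k"
  by (induction m k rule: bd.induct) auto

text \<open>Among the points of \<open>F\<close> above \<open>x\<close> whose row refutes
  \<open>p\<close> somewhere in the class of \<open>u\<close>, choose a maximal \<open>b\<close>.
  Strictly above \<open>b\<close> the variable holds on the whole class, so the inner implication of
  Casari's axiom fails at a refuting point \<open>(b, v)\<close>.\<close>

lemma sat_product_casari:
  assumes F: "logic_frame Grz F" and G: "S5_frame G" and x: "x \<in> worlds F" and u: "u \<in> worlds G"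
  shows "sat (product_frame F G) V (x, u)
    (\<^bold>\<box> \<^bold>\<forall> (\<^bold>\<box> (\<^bold>\<box> (Var 0) \<^bold>\<rightarrow> \<^bold>\<box> \<^bold>\<forall> (Var 0)) \<^bold>\<rightarrow> \<^bold>\<box> \<^bold>\<forall> (Var 0)) \<^bold>\<rightarrow> \<^bold>\<box> \<^bold>\<forall> (Var 0))"
proof (rule ccontr)
  assume neg: "\<not> ?thesis"
  have order: "refl_on (worlds F) (acc F ())" "trans (acc F ())" "antisym (acc F ())"
    using Grz_frame_order[OF F] by (auto simp: partial_order_on_def preorder_on_def)
  have G_equiv: "refl_on (worlds G) (acc G ())" "trans (acc G ())" "sym (acc G ())"
    using G by (auto simp: S5_frame_def equiv_def)
  have in_F: "\<And>x y. (x, y) \<in> acc F () \<Longrightarrow> x \<in> worlds F \<and> y \<in> worlds F"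
    and in_G: "\<And>x y. (x, y) \<in> acc G () \<Longrightarrow> x \<in> worlds G \<and> y \<in> worlds G"
    using F G by (auto simp: logic_frame_def S5_frame_def is_frame_def)
  define S where "S = {b. (x, b) \<in> acc F () \<and> (\<exists>v. (u, v) \<in> acc G () \<and> (b, v) \<notin> V 0)}"
  have "S \<subseteq> worlds F"
    using in_F by (auto simp: S_def)
  moreover have "S \<noteq> {}"
    using neg by (auto simp: S_def)
  ultimately obtain b where b: "b \<in> S" "\<And>c. (b, c) \<in> acc F () \<Longrightarrow> c \<in> S \<Longrightarrow> c = b"
    using Grz_frame_maximal[OF F] by metis
  from b(1) obtain v where v: "(x, b) \<in> acc F ()" "(u, v) \<in> acc G ()" "(b, v) \<notin> V 0"
    by (auto simp: S_def)
  have above: "(d, w) \<in> V 0" if "(b, c) \<in> acc F ()" "c \<noteq> b" "(c, d) \<in> acc F ()" "(v, w) \<in> acc G ()" for c d w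
  proof (rule ccontr)
    assume "(d, w) \<notin> V 0"
    moreover have "(x, d) \<in> acc F ()" "(u, w) \<in> acc G ()" "(b, d) \<in> acc F ()"
      using that v transD[OF order(2)] transD[OF G_equiv(2)] by blast+
    ultimately have "d = b"
      using b(2) by (auto simp: S_def)
    then show False
      using that antisymD[OF order(3)] by blast
  qed
  have mem: "b \<in> worlds F" "v \<in> worlds G" "(b, b) \<in> acc F ()" "(v, v) \<in> acc G ()"
    using v in_F in_G refl_onD[OF order(1)] refl_onD[OF G_equiv(1)] by blast+
  \<comment> \<open>At \<open>(b, v)\<close> itself \<open>\<box>p\<close> fails; at the points
    strictly above, \<open>\<box>\<forall>p\<close> holds by \<open>above\<close>.\<close>
  have "sat (product_frame F G) V (b, v) (\<^bold>\<box> (\<^bold>\<box> (Var 0) \<^bold>\<rightarrow> \<^bold>\<box> \<^bold>\<forall> (Var 0)))"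
    using above mem v(3) by (auto dest: in_F in_G)
  moreover have "\<not> sat (product_frame F G) V (b, v) (\<^bold>\<box> \<^bold>\<forall> (Var 0))"
    using mem v(3) by auto
  ultimately have "\<not> sat (product_frame F G) V (b, v)
      (\<^bold>\<box> (\<^bold>\<box> (Var 0) \<^bold>\<rightarrow> \<^bold>\<box> \<^bold>\<forall> (Var 0)) \<^bold>\<rightarrow> \<^bold>\<box> \<^bold>\<forall> (Var 0))"
    by (simp only: sat.simps) blast
  moreover have "sat (product_frame F G) V (b, v) \<psi>"
    if "sat (product_frame F G) V (x, u) (\<^bold>\<box> \<^bold>\<forall> \<psi>)" for \<psi>
    using that v mem x u by auto
  ultimately show False
    using neg unfolding sat.simps(3)[of _ _ "(x, u)"] by blast
qed

lemma MplusGrzB_depth_sound: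
  assumes F: "logic_frame (Grz_depth n) F" and G: "S5_frame G" and "\<phi> \<in> MplusGrzB_depth n"
  shows "valid (product_frame F G) \<phi>"
proof -
  let ?P = "product_frame F G"
  have FG: "logic_frame Grz F"
    using F by (auto simp: logic_frame_def Grz_depth_def intro: extension.base)
  have bdF: "valid F (bd () n)"
    using F by (auto simp: logic_frame_def Grz_depth_def intro: extension.ax)
  have bdP: "valid ?P (bd DiaM n)"
    using bdF sat_product_DiaM[of _ F _ G _ "bd () n"] unfolding valid_def map_fm_bd by auto
  have in_F: "\<And>x y. (x, y) \<in> acc F () \<Longrightarrow> x \<in> worlds F \<and> y \<in> worlds F"
    and in_G: "\<And>x y. (x, y) \<in> acc G () \<Longrightarrow> x \<in> worlds G \<and> y \<in> worlds G"
    using F G by (auto simp: logic_frame_def S5_frame_def is_frame_def)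
  have "valid ?P \<psi>" if "\<psi> \<in> fusion Grz S5" for \<psi>
    using that unfolding fusion_def
  proof (rule valid_extension)
    show "valid ?P \<psi>" if "\<psi> \<in> map_fm (\<lambda>_. DiaM) ` Grz" for \<psi>
      using that FG by (auto simp: valid_def sat_product_DiaM logic_frame_def)
    show "valid ?P \<psi>" if "\<psi> \<in> map_fm (\<lambda>_. ExM) ` S5" for \<psi>
      using that valid_S5[OF G] by (auto simp: valid_def sat_product_ExM)
  qed
  moreover have "valid ?P (\<^bold>\<exists> \<^bold>\<diamond> (Var 0) \<^bold>\<rightarrow> \<^bold>\<diamond> \<^bold>\<exists> (Var 0))"
    using in_F in_G by (fastforce simp: valid_def)
  moreover have "valid ?P (\<^bold>\<diamond> \<^bold>\<exists> (Var 0) \<^bold>\<rightarrow> \<^bold>\<exists> \<^bold>\<diamond> (Var 0))"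
    using in_F in_G by (fastforce simp: valid_def)
  ultimately have "valid ?P \<psi>" if "\<psi> \<in> MGrzB" for \<psi>
    using that unfolding MGrzB_def
    by (elim valid_extension) auto
  then have "valid ?P \<psi>" if "\<psi> \<in> MplusGrzB" for \<psi>
    using that sat_product_casari[OF FG G] unfolding MplusGrzB_def
    by (elim valid_extension) (auto simp only: valid_def singleton_iff worlds_product_frame)
  then show ?thesis
    using assms(3) bdP unfolding MplusGrzB_depth_def
    by (elim valid_extension) auto
qed

section \<open>The canonical frame of a normal logic\<close>

locale normal_logic =
  fixes L :: "'m fm set"
  assumes taut: "\<phi> \<in> tautologies \<Longrightarrow> \<phi> \<in> L"
    and mp: "\<phi> \<^bold>\<rightarrow> \<psi> \<in> L \<Longrightarrow> \<phi> \<in> L \<Longrightarrow> \<psi> \<in> L"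
    and nec: "\<phi> \<in> L \<Longrightarrow> Box m \<phi> \<in> L"
    and dist: "Box m (\<phi> \<^bold>\<rightarrow> \<psi>) \<^bold>\<rightarrow> Box m \<phi> \<^bold>\<rightarrow> Box m \<psi> \<in> L"
    and dual: "Dia m \<phi> \<^bold>\<rightarrow> \<^bold>\<not> (Box m (\<^bold>\<not> \<phi>)) \<in> L" "\<^bold>\<not> (Box m (\<^bold>\<not> \<phi>)) \<^bold>\<rightarrow> Dia m \<phi> \<in> L"
begin

text \<open>Necessitation is left out: theories represent what holds at a single point.\<close>

definition is_theory :: "'m fm set \<Rightarrow> bool" where
  "is_theory S \<longleftrightarrow> L \<subseteq> S \<and> (\<forall>\<phi> \<psi>. \<phi> \<^bold>\<rightarrow> \<psi> \<in> S \<longrightarrow> \<phi> \<in> S \<longrightarrow> \<psi> \<in> S)"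

text \<open>These are the maximal consistent sets, described by the truth clauses for falsum and
  implication.\<close>

definition world :: "'m fm set \<Rightarrow> bool" where
  "world x \<longleftrightarrow> L \<subseteq> x \<and> Fls \<notin> x \<and> (\<forall>\<phi> \<psi>. \<phi> \<^bold>\<rightarrow> \<psi> \<in> x \<longleftrightarrow> (\<phi> \<in> x \<longrightarrow> \<psi> \<in> x))"

lemma world_L: "world x \<Longrightarrow> \<phi> \<in> L \<Longrightarrow> \<phi> \<in> x"
  by (auto simp: world_def)

lemma world_Fls [simp]: "world x \<Longrightarrow> Fls \<notin> x"
  by (simp add: world_def)

lemma world_Imp [simp]: "world x \<Longrightarrow> \<phi> \<^bold>\<rightarrow> \<psi> \<in> x \<longleftrightarrow> (\<phi> \<in> x \<longrightarrow> \<psi> \<in> x)"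
  by (simp add: world_def)

lemma theory_L: "is_theory L"
  using mp by (auto simp: is_theory_def)

text \<open>If \<open>T\<close> is maximal among the theories omitting \<open>\<phi>\<close> and \<open>\<psi> \<notin> T\<close>, then
  \<open>{\<chi>. \<psi> \<rightarrow> \<chi> \<in> T}\<close> is a strictly larger theory, whence \<open>\<psi> \<rightarrow> \<phi> \<in> T\<close>.\<close>

lemma lindenbaum:
  assumes "is_theory S" "\<phi> \<notin> S"
  obtains x where "world x" "S \<subseteq> x" "\<phi> \<notin> x"
proof -
  let ?A = "{T. is_theory T \<and> S \<subseteq> T \<and> \<phi> \<notin> T}"
  have "\<exists>T\<in>?A. \<forall>X\<in>?A. T \<subseteq> X \<longrightarrow> X = T"
  proof (rule subset_Zorn_nonempty)
    show "?A \<noteq> {}" using assms by blast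
    fix C assume C: "C \<noteq> {}" "subset.chain ?A C"
    have "is_theory (\<Union>C)"
      unfolding is_theory_def
    proof (intro conjI allI impI)
      show "L \<subseteq> \<Union>C"
        using C by (fastforce simp: subset_chain_def is_theory_def)
      fix \<chi> \<psi> assume "\<chi> \<^bold>\<rightarrow> \<psi> \<in> \<Union>C" "\<chi> \<in> \<Union>C"
      then obtain X Y where "X \<in> C" "\<chi> \<^bold>\<rightarrow> \<psi> \<in> X" "Y \<in> C" "\<chi> \<in> Y" by blast
      moreover from this C(2) have "X \<subseteq> Y \<or> Y \<subseteq> X" "is_theory X" "is_theory Y"
        by (auto simp: subset_chain_def)
      ultimately show "\<psi> \<in> \<Union>C"
        unfolding is_theory_def by blast
    qed
    then show "\<Union>C \<in> ?A"
      using C by (fastforce simp: subset_chain_def)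
  qed
  then obtain T where T: "is_theory T" "S \<subseteq> T" "\<phi> \<notin> T"
    and max: "\<And>X. is_theory X \<Longrightarrow> T \<subseteq> X \<Longrightarrow> \<phi> \<notin> X \<Longrightarrow> X = T"
    by (smt (verit) mem_Collect_eq order_trans)
  have in_T: "\<psi> \<in> T" if "\<psi> \<in> tautologies" for \<psi>
    using that taut T(1) by (auto simp: is_theory_def)
  have mpT: "\<psi> \<in> T" if "\<chi> \<^bold>\<rightarrow> \<psi> \<in> T" "\<chi> \<in> T" for \<chi> \<psi>
    using that T(1) by (auto simp: is_theory_def)
  have K: "\<chi> \<^bold>\<rightarrow> \<psi> \<in> T" if "\<psi> \<in> T" for \<chi> \<psi>
    by (rule mpT[OF in_T that]) (simp add: tautologies_def)
  have notin: "\<psi> \<^bold>\<rightarrow> \<phi> \<in> T" if "\<psi> \<notin> T" for \<psi>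
  proof (rule ccontr)
    assume "\<psi> \<^bold>\<rightarrow> \<phi> \<notin> T"
    let ?X = "{\<chi>. \<psi> \<^bold>\<rightarrow> \<chi> \<in> T}"
    have "\<psi> \<^bold>\<rightarrow> \<beta> \<in> T" if "\<psi> \<^bold>\<rightarrow> \<alpha> \<^bold>\<rightarrow> \<beta> \<in> T" "\<psi> \<^bold>\<rightarrow> \<alpha> \<in> T" for \<alpha> \<beta>
      by (rule mpT[OF mpT[OF in_T that(1)] that(2)]) (simp add: tautologies_def)
    then have "is_theory ?X"
      using T(1) K unfolding is_theory_def by blast
    moreover have "T \<subseteq> ?X" using K by blast
    ultimately have "?X = T"
      using max \<open>\<psi> \<^bold>\<rightarrow> \<phi> \<notin> T\<close> by simp
    moreover have "\<psi> \<^bold>\<rightarrow> \<psi> \<in> T"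
      by (rule in_T) (simp add: tautologies_def)
    ultimately show False
      using that by blast
  qed
  have "Fls \<notin> T"
  proof
    assume "Fls \<in> T"
    then have "\<phi> \<in> T"
      by (rule mpT[OF in_T, rotated]) (simp add: tautologies_def)
    then show False using T(3) by simp
  qed
  moreover have "\<chi> \<^bold>\<rightarrow> \<psi> \<in> T" if "\<chi> \<notin> T" for \<chi> \<psi>
  proof (rule ccontr)
    assume "\<chi> \<^bold>\<rightarrow> \<psi> \<notin> T"
    then have "(\<chi> \<^bold>\<rightarrow> \<psi>) \<^bold>\<rightarrow> \<phi> \<in> T" using notin by blast
    \<comment> \<open>A case distinction: one of \<open>\<chi>\<close> and
      \<open>\<chi> \<rightarrow> \<psi>\<close> always holds, and each implies
      \<open>\<phi>\<close> in \<open>T\<close>.\<close>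
    then have "\<phi> \<in> T"
      by (rule mpT[OF mpT[OF in_T _] notin[OF that], rotated]) (auto simp: tautologies_def)
    then show False using T(3) by simp
  qed
  ultimately have "world T"
    using T(1) K mpT unfolding world_def is_theory_def by blast
  then show thesis
    using that T by blast
qed

definition can :: "'m \<Rightarrow> 'm fm set \<Rightarrow> 'm fm set \<Rightarrow> bool" where
  "can m x y \<longleftrightarrow> world x \<and> world y \<and> (\<forall>\<phi>. Box m \<phi> \<in> x \<longrightarrow> \<phi> \<in> y)"

lemma can_world: "can m x y \<Longrightarrow> world x \<and> world y"
  by (simp add: can_def)

lemma can_Imp [simp]: "can m x y \<Longrightarrow> \<phi> \<^bold>\<rightarrow> \<psi> \<in> y \<longleftrightarrow> (\<phi> \<in> y \<longrightarrow> \<psi> \<in> y)"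
  and can_Fls [simp]: "can m x y \<Longrightarrow> Fls \<notin> y"
  by (simp_all add: can_def)

text \<open>By \<open>nec\<close> and \<open>dist\<close> the formulae boxed in \<open>x\<close>
  form a theory; if it omits \<open>\<phi>\<close>, Lindenbaum's lemma extends it to a successor
  omitting \<open>\<phi>\<close>.\<close>

lemma truth_Box:
  assumes "world x"
  shows "Box m \<phi> \<in> x \<longleftrightarrow> (\<forall>y. can m x y \<longrightarrow> \<phi> \<in> y)"
proof
  assume R: "\<forall>y. can m x y \<longrightarrow> \<phi> \<in> y"
  show "Box m \<phi> \<in> x"
  proof (rule ccontr)
    assume "Box m \<phi> \<notin> x"
    moreover have "\<beta> \<in> {\<psi>. Box m \<psi> \<in> x}"
      if "\<alpha> \<^bold>\<rightarrow> \<beta> \<in> {\<psi>. Box m \<psi> \<in> x}" "\<alpha> \<in> {\<psi>. Box m \<psi> \<in> x}" for \<alpha> \<beta>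
      using world_L[OF assms dist[of m \<alpha> \<beta>]] that assms by (simp del: not_imp)
    then have "is_theory {\<psi>. Box m \<psi> \<in> x}"
      using world_L[OF assms nec] unfolding is_theory_def by blast
    ultimately obtain y where "world y" "{\<psi>. Box m \<psi> \<in> x} \<subseteq> y" "\<phi> \<notin> y"
      using lindenbaum[of "{\<psi>. Box m \<psi> \<in> x}" \<phi>] by blast
    then show False
      using R assms unfolding can_def by blast
  qed
qed (auto simp: can_def)

lemma truth_Dia:
  assumes "world x"
  shows "Dia m \<phi> \<in> x \<longleftrightarrow> (\<exists>y. can m x y \<and> \<phi> \<in> y)"
proof -
  have "Dia m \<phi> \<in> x \<longleftrightarrow> Box m (\<^bold>\<not> \<phi>) \<notin> x"
    using world_L[OF assms dual(1)[of m \<phi>]] world_L[OF assms dual(2)[of m \<phi>]] assms by auto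
  also have "\<dots> \<longleftrightarrow> (\<exists>y. can m x y \<and> \<phi> \<in> y)"
    unfolding truth_Box[OF assms] using can_Imp can_Fls by blast
  finally show ?thesis .
qed

lemma canI:
  assumes "world x" "world y" "\<And>\<phi>. \<phi> \<in> y \<Longrightarrow> Dia m \<phi> \<in> x"
  shows "can m x y"
  unfolding can_def
proof (intro conjI allI impI, rule assms(1), rule assms(2), rule ccontr)
  fix \<phi> assume "Box m \<phi> \<in> x" "\<phi> \<notin> y"
  then show False
    using assms(3)[of "\<^bold>\<not> \<phi>"] assms(1,2) by simp
qed

text \<open>The midpoint must contain everything \<open>a\<close>-boxed in \<open>x\<close> and
  refute \<open>Box b \<phi>\<close> for every \<open>\<phi>\<close> outside \<open>y\<close>.
  \<open>?S\<close> is the theory generated by these demands. A single \<open>\<phi>\<close>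
  suffices in its description because the complement of \<open>y\<close> is closed under
  disjunction, and the hypothesis is exactly its consistency.\<close>

lemma can_comp:
  assumes x: "world x" and y: "world y" and xy: "\<And>\<phi>. Box a (Box b \<phi>) \<in> x \<Longrightarrow> \<phi> \<in> y"
  obtains z where "can a x z" "can b z y"
proof -
  let ?S = "{\<chi>. \<exists>\<phi>. \<phi> \<notin> y \<and> Box a (\<^bold>\<not> Box b \<phi> \<^bold>\<rightarrow> \<chi>) \<in> x}"
  have S: "\<chi> \<in> ?S \<longleftrightarrow> (\<exists>\<phi>. \<phi> \<notin> y \<and> (\<forall>z. can a x z \<longrightarrow> (\<forall>w. can b z w \<longrightarrow> \<phi> \<in> w) \<or> \<chi> \<in> z))" for \<chi>
  proof -
    have "\<^bold>\<not> Box b \<phi> \<^bold>\<rightarrow> \<chi> \<in> z \<longleftrightarrow> (\<forall>w. can b z w \<longrightarrow> \<phi> \<in> w) \<or> \<chi> \<in> z" if "can a x z" for z \<phi>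
      using that truth_Box[of z b \<phi>] can_world can_Imp can_Fls by metis
    then show ?thesis
      unfolding mem_Collect_eq truth_Box[OF x] by blast
  qed
  have mpS: "\<psi> \<in> ?S" if hyp: "\<chi> \<^bold>\<rightarrow> \<psi> \<in> ?S" "\<chi> \<in> ?S" for \<chi> \<psi>
  proof -
    obtain \<alpha> \<beta> where "\<alpha> \<notin> y" "\<And>z. can a x z \<Longrightarrow> (\<forall>w. can b z w \<longrightarrow> \<alpha> \<in> w) \<or> \<chi> \<^bold>\<rightarrow> \<psi> \<in> z"
      "\<beta> \<notin> y" "\<And>z. can a x z \<Longrightarrow> (\<forall>w. can b z w \<longrightarrow> \<beta> \<in> w) \<or> \<chi> \<in> z"
      using hyp unfolding S by blast
    \<comment> \<open>The witness is the disjunction of \<open>\<alpha>\<close> and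
      \<open>\<beta>\<close>, which is outside \<open>y\<close> and implied by both.\<close>
    then show ?thesis
      unfolding S using y by (intro exI[of _ "\<^bold>\<not> \<alpha> \<^bold>\<rightarrow> \<beta>"]) (auto dest: can_world)
  qed
  have "L \<subseteq> ?S"
  proof
    fix \<chi> assume "\<chi> \<in> L"
    then show "\<chi> \<in> ?S"
      unfolding S using world_L can_world world_Fls[OF y] by blast
  qed
  then have "is_theory ?S"
    using mpS unfolding is_theory_def by blast
  moreover have "Fls \<notin> ?S"
  proof
    assume "Fls \<in> ?S"
    then obtain \<phi> where "\<phi> \<notin> y" "\<And>z w. can a x z \<Longrightarrow> can b z w \<Longrightarrow> \<phi> \<in> w"
      unfolding S using can_world world_Fls by blast
    moreover from this have "Box a (Box b \<phi>) \<in> x"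
      unfolding truth_Box[OF x] using truth_Box can_world by blast
    ultimately show False
      using xy by blast
  qed
  ultimately obtain z where z: "world z" "?S \<subseteq> z" "Fls \<notin> z"
    by (rule lindenbaum)
  have "\<chi> \<in> ?S" if "Box a \<chi> \<in> x" for \<chi>
    unfolding S using that truth_Box[OF x] world_Fls[OF y] by blast
  then have "can a x z"
    using x z unfolding can_def by blast
  moreover have "\<phi> \<in> y" if "Box b \<phi> \<in> z" for \<phi>
  proof (rule ccontr)
    assume "\<phi> \<notin> y"
    then have "\<^bold>\<not> Box b \<phi> \<in> ?S"
      unfolding S using truth_Box can_world world_Imp world_Fls by metis
    then show False
      using z that world_Imp[OF z(1)] world_Fls[OF z(1)] by blast
  qed
  then have "can b z y"
    using y z unfolding can_def by blast
  ultimately show thesis using that by blast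
qed

lemma world_eqI:
  assumes "world x" "world y" "\<And>\<phi>. \<phi> \<in> x \<Longrightarrow> \<phi> \<in> y"
  shows "x = y"
proof (rule set_eqI)
  fix \<phi> show "\<phi> \<in> x \<longleftrightarrow> \<phi> \<in> y"
    using assms(3)[of \<phi>] assms(3)[of "\<^bold>\<not> \<phi>"] assms(1,2) by auto
qed

text \<open>\<open>B\<close> stands for a definable box with canonical relation \<open>Q\<close>; the instances are \<open>\<box>\<close> with \<open>R\<close>
  and \<open>\<box>\<forall>\<close> with \<open>R O E\<close>.\<close>

lemma strict_chain_formula:
  assumes Q: "\<And>x y. Q x y \<Longrightarrow> world x \<and> world y"
    and B: "\<And>x \<phi>. world x \<Longrightarrow> B \<phi> \<in> x \<longleftrightarrow> (\<forall>y. Q x y \<longrightarrow> \<phi> \<in> y)"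
    and sep: "\<And>x y. world x \<Longrightarrow> world y \<Longrightarrow> \<not> Q y x \<Longrightarrow> \<exists>\<phi>. B \<phi> \<in> y \<and> \<phi> \<notin> x"
    and "world x" "strict_chain Q k x"
  shows "\<exists>\<chi>. \<chi> \<notin> x \<and> (\<forall>y. world y \<longrightarrow> \<not> strict_chain Q k y \<longrightarrow> \<chi> \<in> y)"
  using assms(4,5)
proof (induction k arbitrary: x)
  case 0
  then show ?case by (intro exI[of _ Fls]) auto
next
  case (Suc k)
  then obtain x1 where x1: "Q x x1" "\<not> Q x1 x" "strict_chain Q k x1" by auto
  then obtain \<chi> where \<chi>: "\<chi> \<notin> x1" "\<And>y. world y \<Longrightarrow> \<not> strict_chain Q k y \<Longrightarrow> \<chi> \<in> y"
    using Suc.IH Q by blast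
  obtain p where p: "B p \<in> x1" "p \<notin> x"
    using sep Suc.prems(1) x1 Q by blast
  \<comment> \<open>This is the recursion of \<open>bd\<close> with \<open>B\<close> as the box.
    Where it fails, some \<open>Q\<close>-successor satisfies \<open>B p\<close> and refutes
    \<open>\<chi>\<close>; it cannot see back because \<open>p\<close> fails below.\<close>
  let ?\<chi> = "\<^bold>\<not> B (B p \<^bold>\<rightarrow> \<chi>) \<^bold>\<rightarrow> p"
  have val: "?\<chi> \<in> y \<longleftrightarrow> (\<forall>z. Q y z \<longrightarrow> B p \<in> z \<longrightarrow> \<chi> \<in> z) \<or> p \<in> y" if "world y" for y
    using that Q by (auto simp: B)
  have "?\<chi> \<notin> x"
    using val[OF Suc.prems(1)] p x1(1) \<chi>(1) by blast
  moreover have "?\<chi> \<in> y" if y: "world y" "\<not> strict_chain Q (Suc k) y" for y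
  proof (rule ccontr)
    assume "?\<chi> \<notin> y"
    then obtain z where "Q y z" "B p \<in> z" "\<chi> \<notin> z" "p \<notin> y"
      using val[OF y(1)] by blast
    then show False
      using y Q B \<chi>(2) by (metis strict_chain.simps(2))
  qed
  ultimately show ?case by blast
qed

text \<open>Let \<open>k\<close> be the exact maximal length of strict chains from \<open>x\<close>.
  Strictly above \<open>x\<close> the chains are shorter, so a formula detecting chains of length
  \<open>k\<close> fails at \<open>x\<close> and holds there; boxing it carries the failure to
  everything that sees \<open>x\<close>.\<close>

lemma cluster_formula:
  assumes Q: "\<And>x y. Q x y \<Longrightarrow> world x \<and> world y"
    and B: "\<And>x \<phi>. world x \<Longrightarrow> B \<phi> \<in> x \<longleftrightarrow> (\<forall>y. Q x y \<longrightarrow> \<phi> \<in> y)"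
    and sep: "\<And>x y. world x \<Longrightarrow> world y \<Longrightarrow> \<not> Q y x \<Longrightarrow> \<exists>\<phi>. B \<phi> \<in> y \<and> \<phi> \<notin> x"
    and tr: "transp Q" and x: "world x" and chain: "\<not> strict_chain Q n x"
  shows "\<exists>T. (\<forall>y. Q y x \<longrightarrow> T \<notin> y) \<and> (\<forall>y. Q x y \<longrightarrow> \<not> Q y x \<longrightarrow> T \<in> y)"
proof -
  have "\<exists>k. strict_chain Q k x \<and> \<not> strict_chain Q (Suc k) x"
  proof (rule ccontr)
    assume "\<not> ?thesis"
    then have "strict_chain Q k x" for k by (induction k) auto
    then show False using chain by blast
  qed
  then obtain k where k: "strict_chain Q k x" "\<not> strict_chain Q (Suc k) x" by blast
  obtain \<theta> where \<theta>: "\<theta> \<notin> x" "\<And>y. world y \<Longrightarrow> \<not> strict_chain Q k y \<Longrightarrow> \<theta> \<in> y"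
    using strict_chain_formula[of Q B x k] Q B sep x k(1) by blast
  show ?thesis
  proof (intro exI[of _ "B \<theta>"] conjI allI impI)
    show "B \<theta> \<notin> y" if "Q y x" for y
      using that \<theta>(1) B Q by blast
    show "B \<theta> \<in> y" if y: "Q x y" "\<not> Q y x" for y
    proof -
      have "\<theta> \<in> z" if "Q y z" for z
      proof -
        have "Q x z" "\<not> Q z x"
          using that y transpD[OF tr] by blast+
        then show ?thesis
          using \<theta>(2) k(2) Q by auto
      qed
      then show ?thesis
        using B Q y by blast
    qed
  qed
qed

end

section \<open>The canonical frame of \<open>M\<^sup>+GrzB[n]\<close>\<close>

text \<open>Axioms are assumed in all instances, so that worlds can be handled without substitution;
  \<open>bd\<close> has several variables, hence the explicit \<open>\<sigma>\<close>.\<close>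

locale casari_logic = normal_logic L for L :: "modality fm set" +
  fixes n :: nat
  assumes grz: "\<^bold>\<box> (\<^bold>\<box> (p \<^bold>\<rightarrow> \<^bold>\<box> p) \<^bold>\<rightarrow> p) \<^bold>\<rightarrow> p \<in> L"
    and ex_refl: "p \<^bold>\<rightarrow> \<^bold>\<exists> p \<in> L"
    and ex_trans: "\<^bold>\<exists> \<^bold>\<exists> p \<^bold>\<rightarrow> \<^bold>\<exists> p \<in> L"
    and ex_sym: "p \<^bold>\<rightarrow> \<^bold>\<forall> \<^bold>\<exists> p \<in> L"
    and ex_dia: "\<^bold>\<exists> \<^bold>\<diamond> p \<^bold>\<rightarrow> \<^bold>\<diamond> \<^bold>\<exists> p \<in> L"
    and dia_ex: "\<^bold>\<diamond> \<^bold>\<exists> p \<^bold>\<rightarrow> \<^bold>\<exists> \<^bold>\<diamond> p \<in> L"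
    and casari: "\<^bold>\<box> \<^bold>\<forall> (\<^bold>\<box> (\<^bold>\<box> p \<^bold>\<rightarrow> \<^bold>\<box> \<^bold>\<forall> p) \<^bold>\<rightarrow> \<^bold>\<box> \<^bold>\<forall> p) \<^bold>\<rightarrow> \<^bold>\<box> \<^bold>\<forall> p \<in> L"
    and depth: "subst \<sigma> (bd DiaM n) \<in> L"
    and n_pos: "n \<ge> 1"
begin

abbreviation R where "R \<equiv> can DiaM"
abbreviation E where "E \<equiv> can ExM"

section \<open>\<open>E\<close> is an equivalence relation and \<open>R\<close> a preorder\<close>

lemma E_refl: "world x \<Longrightarrow> E x x"
  by (rule canI) (use world_L[OF _ ex_refl] world_Imp in blast)+

lemma E_trans: "E x y \<Longrightarrow> E y z \<Longrightarrow> E x z"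
proof (rule canI)
  fix \<phi> assume *: "E x y" "E y z" "\<phi> \<in> z"
  then have "world x" "\<^bold>\<exists> \<^bold>\<exists> \<phi> \<in> x"
    using truth_Dia can_world by metis+
  then show "\<^bold>\<exists> \<phi> \<in> x"
    using world_L[OF _ ex_trans[of \<phi>]] by auto
qed (simp_all add: can_world)

lemma E_sym: "E x y \<Longrightarrow> E y x"
proof (rule canI)
  fix \<phi> assume *: "E x y" "\<phi> \<in> x"
  then have "world x" "\<^bold>\<forall> \<^bold>\<exists> \<phi> \<in> x"
    using world_L[OF _ ex_sym[of \<phi>]] can_world[OF *(1)] world_Imp by blast+
  then show "\<^bold>\<exists> \<phi> \<in> y"
    using * truth_Box by blast
qed (simp_all add: can_world)

text \<open>The Grz axiom as an induction principle: only successors above which \<open>p\<close> is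
  persistent have to be checked. Reflexivity, transitivity and antisymmetry of \<open>R\<close> all
  come from it.\<close>

lemma grz_world:
  assumes "world x" "\<And>y. R x y \<Longrightarrow> \<forall>z. R y z \<longrightarrow> p \<in> z \<longrightarrow> \<^bold>\<box> p \<in> z \<Longrightarrow> p \<in> y"
  shows "p \<in> x"
proof -
  have "\<^bold>\<box> (\<^bold>\<box> (p \<^bold>\<rightarrow> \<^bold>\<box> p) \<^bold>\<rightarrow> p) \<in> x"
    unfolding truth_Box[OF assms(1)]
  proof (intro allI impI)
    fix y assume y: "R x y"
    then have "\<^bold>\<box> (p \<^bold>\<rightarrow> \<^bold>\<box> p) \<in> y \<longleftrightarrow> (\<forall>z. R y z \<longrightarrow> p \<in> z \<longrightarrow> \<^bold>\<box> p \<in> z)"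
      using truth_Box[of y] can_world can_Imp by blast
    then show "\<^bold>\<box> (p \<^bold>\<rightarrow> \<^bold>\<box> p) \<^bold>\<rightarrow> p \<in> y"
      using assms(2)[OF y] can_Imp[OF y] by blast
  qed
  then show ?thesis
    using world_L[OF assms(1) grz[of p]] assms(1) world_Imp by blast
qed

lemma R_refl:
  assumes "world x"
  shows "R x x"
  unfolding can_def
proof (intro conjI allI impI assms)
  fix p assume "\<^bold>\<box> p \<in> x"
  then show "p \<in> x"
    using grz_world[OF assms] truth_Box[OF assms] by blast
qed

text \<open>The Grz axiom is applied to \<open>p \<and> (\<box>p \<rightarrow> \<box>\<box>p)\<close>.\<close>

lemma R_trans:
  assumes "R x y" "R y z"
  shows "R x z"
  unfolding can_def
proof (intro conjI allI impI)
  show x: "world x" and "world z"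
    using assms can_world by auto
  fix p assume p: "\<^bold>\<box> p \<in> x"
  let ?q = "p \<^bold>\<and> (\<^bold>\<box> p \<^bold>\<rightarrow> \<^bold>\<box> \<^bold>\<box> p)"
  have q: "?q \<in> w \<longleftrightarrow> p \<in> w \<and> (\<^bold>\<box> p \<in> w \<longrightarrow> \<^bold>\<box> \<^bold>\<box> p \<in> w)" if "world w" for w
    using that by auto
  have "?q \<in> x"
  proof (rule grz_world[OF x])
    fix w assume w: "R x w" "\<forall>z. R w z \<longrightarrow> ?q \<in> z \<longrightarrow> \<^bold>\<box> ?q \<in> z"
    have ww: "world w" using w can_world by blast
    have "\<^bold>\<box> \<^bold>\<box> p \<in> w" if "\<^bold>\<box> p \<in> w"
    proof (rule ccontr)
      assume "\<^bold>\<box> \<^bold>\<box> p \<notin> w"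
      then obtain v where v: "R w v" "\<^bold>\<box> p \<notin> v"
        using truth_Box[OF ww] by blast
      then have "p \<in> v" "world v"
        using that truth_Box[OF ww] can_world by blast+
      \<comment> \<open>\<open>?q\<close> holds at \<open>v\<close> because \<open>p\<close> does
        and \<open>\<box>p\<close> fails there; persistence then yields \<open>\<box>p\<close> at
        \<open>v\<close> after all.\<close>
      then have "\<^bold>\<box> ?q \<in> v"
        using v w(2) q by blast
      then have "\<^bold>\<box> p \<in> v"
        using truth_Box[OF \<open>world v\<close>] q can_world by blast
      then show False using v by blast
    qed
    then show "?q \<in> w"
      using w p q[OF ww] truth_Box[OF x] by blast
  qed
  then have "\<^bold>\<box> \<^bold>\<box> p \<in> x"
    using p q[OF x] by blast
  then show "p \<in> z"
    using assms truth_Box can_world by blast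
qed

section \<open>Depth and antisymmetry of \<open>R\<close>\<close>

lemma transp_R: "transp R"
  by (blast intro: transpI R_trans)

text \<open>Canonical counterpart of the converse of \<open>not_sat_bd\<close>: each strict step
  supplies a formula boxed at its upper end and false at its lower end, to be substituted for the
  variable of that level.\<close>

lemma strict_chain_not_bd:
  assumes "k \<ge> 1" "world x" "strict_chain R k x"
  shows "\<exists>\<sigma>. subst \<sigma> (bd DiaM k) \<notin> x"
  using assms
proof (induction k arbitrary: x rule: nat_induct_at_least)
  case base
  then obtain y where y: "R x y" "\<not> R y x" by auto
  then obtain p where "\<^bold>\<box> p \<in> y" "p \<notin> x"
    using base can_world unfolding can_def by blast
  then have "\<^bold>\<diamond> \<^bold>\<box> p \<^bold>\<rightarrow> p \<notin> x"
    using y truth_Dia[OF base(1)] world_Imp[OF base(1)] by blast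
  then show ?case
    by (intro exI[of _ "\<lambda>_. p"]) simp
next
  case (Suc k)
  then obtain y where y: "R x y" "\<not> R y x" "strict_chain R k y" by auto
  then have wy: "world y" using can_world by blast
  obtain \<sigma> where \<sigma>: "subst \<sigma> (bd DiaM k) \<notin> y"
    using Suc.IH wy y by blast
  obtain p where p: "\<^bold>\<box> p \<in> y" "p \<notin> x"
    using y(2) Suc.prems(1) wy unfolding can_def by blast
  define \<tau> where "\<tau> = \<sigma>(Suc k := p)"
  \<comment> \<open>The variable \<open>Suc k\<close> is new at this level, so the update leaves the
    lower formulae alone.\<close>
  have restrict: "j < Suc k \<Longrightarrow> subst \<tau> (bd DiaM j) = subst \<sigma> (bd DiaM j)" for j
    by (induction DiaM j rule: bd.induct) (auto simp: \<tau>_def)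
  obtain j where j: "k = Suc j" using Suc.hyps by (cases k) auto
  have "\<^bold>\<box> p \<^bold>\<and> \<^bold>\<not> subst \<sigma> (bd DiaM k) \<in> y"
    using p \<sigma> wy by simp
  then have "\<^bold>\<diamond> (\<^bold>\<box> p \<^bold>\<and> \<^bold>\<not> subst \<sigma> (bd DiaM k)) \<in> x"
    using truth_Dia[OF Suc.prems(1)] y by blast
  moreover have "subst \<tau> (bd DiaM (Suc k)) = \<^bold>\<diamond> (\<^bold>\<box> p \<^bold>\<and> \<^bold>\<not> subst \<sigma> (bd DiaM k)) \<^bold>\<rightarrow> p"
    using restrict[of k] by (simp add: j \<tau>_def)
  ultimately have "subst \<tau> (bd DiaM (Suc k)) \<notin> x"
    using p(2) world_Imp[OF Suc.prems(1)] by simp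
  then show ?case by blast
qed

lemma R_depth: "world x \<Longrightarrow> \<not> strict_chain R n x"
  using strict_chain_not_bd n_pos depth world_L by blast

lemma R_separated: "world x \<Longrightarrow> world y \<Longrightarrow> \<not> R y x \<Longrightarrow> \<exists>p. \<^bold>\<box> p \<in> y \<and> p \<notin> x"
  unfolding can_def by blast

text \<open>Grz is applied at \<open>y\<close> to \<open>p\<close> relativised by a formula
  \<open>T\<close> that fails on the cluster of \<open>y\<close> and holds strictly above it. Any
  \<open>z\<close> in the cluster sees \<open>x\<close>, where \<open>p\<close> holds, and
  persistence carries the relativised formula from \<open>x\<close> back to
  \<open>z\<close>.\<close>

lemma R_antisym:
  assumes "R x y" "R y x"
  shows "x = y"
proof (rule world_eqI)
  show x: "world x" and y: "world y" using assms can_world by auto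
  fix p assume p: "p \<in> x"
  have "\<exists>T. (\<forall>z. R z y \<longrightarrow> T \<notin> z) \<and> (\<forall>z. R y z \<longrightarrow> \<not> R z y \<longrightarrow> T \<in> z)"
    by (rule cluster_formula[where B = "Box DiaM" and n = n])
       (fact can_world truth_Box R_separated transp_R y R_depth[OF y])+
  then obtain T where T: "\<And>z. R z y \<Longrightarrow> T \<notin> z" "\<And>z. R y z \<Longrightarrow> \<not> R z y \<Longrightarrow> T \<in> z"
    by blast
  have q: "\<^bold>\<not> T \<^bold>\<rightarrow> p \<in> z \<longleftrightarrow> T \<in> z \<or> p \<in> z" if "world z" for z
    using that by auto
  have "\<^bold>\<not> T \<^bold>\<rightarrow> p \<in> y"
  proof (rule grz_world[OF y])
    fix z assume z: "R y z" "\<forall>w. R z w \<longrightarrow> \<^bold>\<not> T \<^bold>\<rightarrow> p \<in> w \<longrightarrow> \<^bold>\<box> (\<^bold>\<not> T \<^bold>\<rightarrow> p) \<in> w"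
    show "\<^bold>\<not> T \<^bold>\<rightarrow> p \<in> z"
    proof (cases "R z y")
      case True
      then have "R z x" "R x z"
        using assms z R_trans by blast+
      then show ?thesis
        using z(2) p q[OF x] truth_Box[OF x] by blast
    next
      case False
      then show ?thesis
        using T(2) z q can_world by blast
    qed
  qed
  then show "p \<in> y"
    using q[OF y] T(1) R_refl[OF y] by blast
qed

lemma antisymp_R: "antisymp R"
  by (rule antisympI) (rule R_antisym)

section \<open>Commutation of \<open>R\<close> and \<open>E\<close>\<close>

lemma E_R_commute:
  assumes "E x y" "R y z"
  obtains w where "R x w" "E w z"
\<comment> \<open>A formula violating the premise would be false at \<open>z\<close>, so its
  negation gives \<open>\<exists>\<diamond>\<close> at \<open>x\<close>, and \<open>ex_dia\<close>
  turns this into \<open>\<diamond>\<exists>\<close>, against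
  \<open>\<box>\<forall>\<close>.\<close>
proof (rule can_comp[of x z DiaM ExM])
  show x: "world x" and z: "world z" using assms can_world by auto
  fix p assume *: "\<^bold>\<box> \<^bold>\<forall> p \<in> x"
  show "p \<in> z"
  proof (rule ccontr)
    assume "p \<notin> z"
    then have "\<^bold>\<not> p \<in> z" using z by simp
    then have "\<^bold>\<exists> \<^bold>\<diamond> (\<^bold>\<not> p) \<in> x"
      using truth_Dia assms can_world by blast
    then have "\<^bold>\<diamond> \<^bold>\<exists> (\<^bold>\<not> p) \<in> x"
      using world_L[OF x ex_dia[of "\<^bold>\<not> p"]] x world_Imp by blast
    then show False
      using * x truth_Dia truth_Box can_world can_Imp can_Fls by blast
  qed
qed

lemma R_E_commute:
  assumes "R x y" "E y z"
  obtains w where "E x w" "R w z"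
proof (rule can_comp[of x z ExM DiaM])
  show x: "world x" and z: "world z" using assms can_world by auto
  fix p assume *: "\<^bold>\<forall> \<^bold>\<box> p \<in> x"
  show "p \<in> z"
  proof (rule ccontr)
    assume "p \<notin> z"
    then have "\<^bold>\<not> p \<in> z" using z by simp
    then have "\<^bold>\<diamond> \<^bold>\<exists> (\<^bold>\<not> p) \<in> x"
      using truth_Dia assms can_world by blast
    then have "\<^bold>\<exists> \<^bold>\<diamond> (\<^bold>\<not> p) \<in> x"
      using world_L[OF x dia_ex[of "\<^bold>\<not> p"]] x world_Imp by blast
    then show False
      using * x truth_Dia truth_Box can_world can_Imp can_Fls by blast
  qed
qed

section \<open>The relation \<open>Q\<close> of \<open>\<box>\<forall>\<close>, and
  cleanness\<close>

definition Q where "Q x z \<longleftrightarrow> (\<exists>y. R x y \<and> E y z)"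

lemma Q_world: "Q x y \<Longrightarrow> world x \<and> world y"
  using can_world by (auto simp: Q_def)

lemma R_Q: "R x y \<Longrightarrow> Q x y" and E_Q: "E x y \<Longrightarrow> Q x y"
  unfolding Q_def using E_refl[of y] R_refl[of x] can_world by blast+

lemma Q_trans:
  assumes "Q x y" "Q y z"
  shows "Q x z"
proof -
  obtain a b where ab: "R x a" "E a y" "R y b" "E b z"
    using assms by (auto simp: Q_def)
  obtain w where "R a w" "E w b"
    using E_R_commute[OF ab(2,3)] .
  then show ?thesis
    using R_trans[OF ab(1)] E_trans[OF _ ab(4)] unfolding Q_def by blast
qed

lemma transp_Q: "transp Q"
  by (blast intro: transpI Q_trans)

lemma truth_Q: "world x \<Longrightarrow> \<^bold>\<box> \<^bold>\<forall> p \<in> x \<longleftrightarrow> (\<forall>y. Q x y \<longrightarrow> p \<in> y)"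
  unfolding Q_def using truth_Box can_world by blast

lemma Q_separated: "world x \<Longrightarrow> world y \<Longrightarrow> \<not> Q y x \<Longrightarrow> \<exists>p. \<^bold>\<box> \<^bold>\<forall> p \<in> y \<and> p \<notin> x"
  using can_comp[of y x DiaM ExM] unfolding Q_def by blast

text \<open>A strict \<open>Q\<close>-step factors into an \<open>R\<close>-step, again strict,
  followed by an \<open>E\<close>-step. Strict \<open>Q\<close>-chains may be restarted at any
  \<open>E\<close>-equivalent point, so they convert into \<open>R\<close>-chains of the same
  length.\<close>

lemma Q_depth:
  assumes "world x"
  shows "\<not> strict_chain Q n x"
proof -
  have E_inv: "strict_chain Q k y" if "strict_chain Q k x" "E x y" for k x y
  proof (cases k)
    case (Suc j)
    then obtain z where "Q x z" "\<not> Q z x" "strict_chain Q j z"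
      using \<open>strict_chain Q k x\<close> by auto
    moreover from this have "Q y z" "\<not> Q z y"
      using E_Q[OF \<open>E x y\<close>] E_Q[OF E_sym[OF \<open>E x y\<close>]] Q_trans by blast+
    ultimately show ?thesis
      using Suc by auto
  qed simp
  have "strict_chain R k x" if "strict_chain Q k x" for k x
    using that
  proof (induction k arbitrary: x)
    case (Suc k)
    then obtain z where z: "Q x z" "\<not> Q z x" "strict_chain Q k z" by auto
    then obtain y where y: "R x y" "E y z" by (auto simp: Q_def)
    then have "strict_chain R k y"
      using Suc.IH E_inv z E_sym by blast
    moreover have "\<not> R y x"
      using y z E_Q R_Q E_sym Q_trans by blast
    ultimately show ?case using y by auto
  qed simp
  then show ?thesis
    using R_depth assms by blast
qed

text \<open>If \<open>R\<close> were nontrivial inside the \<open>Q\<close>-cluster of \<open>x\<close>, Casari's axiom would be refuted by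
  making \<open>p\<close> true above the cluster and at its \<open>R\<close>-maximal points, but false at \<open>x\<close>.\<close>

lemma R_clean:
  assumes "R x y" "Q y x"
  shows "x = y"
proof (rule world_eqI)
  show x: "world x" and y: "world y" using assms can_world by auto
  fix q assume qx: "q \<in> x"
  show "q \<in> y"
  proof (rule ccontr)
    assume qy: "q \<notin> y"
    have "\<exists>T. (\<forall>z. Q z x \<longrightarrow> T \<notin> z) \<and> (\<forall>z. Q x z \<longrightarrow> \<not> Q z x \<longrightarrow> T \<in> z)"
      by (rule cluster_formula[where B = "\<lambda>p. \<^bold>\<box> \<^bold>\<forall> p" and n = n])
         (fact Q_world truth_Q Q_separated transp_Q x Q_depth[OF x])+
    then obtain T where T: "\<And>z. Q z x \<Longrightarrow> T \<notin> z" "\<And>z. Q x z \<Longrightarrow> \<not> Q z x \<Longrightarrow> T \<in> z"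
      by blast
    \<comment> \<open>\<open>p\<close> fails where \<open>q\<close> holds but is lost at an
      \<open>R\<close>-successor refuting \<open>T\<close>. Such a successor of a point above
      \<open>x\<close> lies in the cluster of \<open>x\<close>; at \<open>x\<close> it is
      \<open>y\<close>.\<close>
    define p where "p = \<^bold>\<not> (q \<^bold>\<and> \<^bold>\<diamond> (\<^bold>\<not> T \<^bold>\<and> \<^bold>\<not> q))"
    have p: "p \<in> z \<longleftrightarrow> (q \<in> z \<longrightarrow> (\<forall>w. R z w \<longrightarrow> T \<in> w \<or> q \<in> w))" if "world z" for z
    proof -
      have "p \<in> z \<longleftrightarrow> (q \<in> z \<longrightarrow> \<^bold>\<diamond> (\<^bold>\<not> T \<^bold>\<and> \<^bold>\<not> q) \<notin> z)"
        using that by (simp add: p_def)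
      moreover have "\<^bold>\<not> T \<^bold>\<and> \<^bold>\<not> q \<in> w \<longleftrightarrow> T \<notin> w \<and> q \<notin> w" if "R z w" for w
        using that by simp
      ultimately show ?thesis
        unfolding truth_Dia[OF that] by blast
    qed
    have px: "p \<notin> x"
      using p[OF x] qx qy assms(1) T(1)[OF assms(2)] by metis
    have above: "p \<in> w" if "Q x w" "\<not> Q w x" for w
    proof -
      have "T \<in> v" if "R w v" for v
        using T(2)[of v] \<open>Q x w\<close> \<open>\<not> Q w x\<close> Q_trans R_Q[OF that] by blast
      then show ?thesis
        using p[of w] Q_world[OF \<open>Q x w\<close>] by blast
    qed
    have "\<^bold>\<box> (\<^bold>\<box> p \<^bold>\<rightarrow> \<^bold>\<box> \<^bold>\<forall> p) \<^bold>\<rightarrow> \<^bold>\<box> \<^bold>\<forall> p \<in> w" if w: "Q x w" for w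
    proof (cases "Q w x")
      case False
      have "\<^bold>\<box> \<^bold>\<forall> p \<in> w"
        using truth_Q[of w p] Q_world[OF w] above Q_trans w False by blast
      then show ?thesis
        using Q_world w by simp
    next
      case True
      have ww: "world w" using w Q_world by blast
      \<comment> \<open>At an \<open>R\<close>-maximal point \<open>m\<close> of the cluster,
        \<open>q\<close> cannot be lost within the cluster, so \<open>\<box>p\<close> holds, whereas
        \<open>\<box>\<forall>p\<close> fails because \<open>m\<close> reaches \<open>x\<close>.
        This falsifies the antecedent at \<open>w\<close>.\<close>
      obtain m where m: "R w m" "Q m x" "\<And>v. R m v \<Longrightarrow> Q v x \<Longrightarrow> v = m"
        using maximal_above[OF transp_R antisymp_R R_depth[OF ww] R_refl[OF ww], of "\<lambda>v. Q v x"] True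
        by blast
      have wm: "world m" using m can_world by blast
      have xm: "Q x m" using w m R_Q Q_trans by blast
      have "p \<in> v" if v: "R m v" for v
      proof (rule ccontr)
        assume "p \<notin> v"
        then obtain u where u: "q \<in> v" "R v u" "T \<notin> u" "q \<notin> u"
          using p v can_world by blast
        then have "Q u x"
          using T(2)[OF Q_trans[OF xm Q_trans[OF R_Q[OF v] R_Q[OF u(2)]]]] by blast
        then have "v = m" "u = m"
          using m(3) v u(2) R_trans[OF v u(2)] Q_trans[OF R_Q[OF u(2)]] by blast+
        then show False
          using u by blast
      qed
      then have "\<^bold>\<box> p \<in> m" using truth_Box[OF wm] by blast
      moreover have "\<^bold>\<box> \<^bold>\<forall> p \<notin> m"
        using truth_Q[OF wm] m px by blast
      ultimately have "\<^bold>\<box> p \<^bold>\<rightarrow> \<^bold>\<box> \<^bold>\<forall> p \<notin> m"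
        using world_Imp[OF wm] by blast
      then show ?thesis
        using truth_Box[OF ww] m(1) world_Imp[OF ww] by blast
    qed
    then have "\<^bold>\<box> \<^bold>\<forall> (\<^bold>\<box> (\<^bold>\<box> p \<^bold>\<rightarrow> \<^bold>\<box> \<^bold>\<forall> p) \<^bold>\<rightarrow> \<^bold>\<box> \<^bold>\<forall> p) \<in> x"
      using truth_Q[OF x] by blast
    then have "\<^bold>\<box> \<^bold>\<forall> p \<in> x"
      using world_L[OF x casari[of p]] world_Imp[OF x] by blast
    then show False
      using truth_Q[OF x] px E_Q[OF E_refl[OF x]] by blast
  qed
qed

end

section \<open>Countable submodels of the canonical model\<close>

definition p_morphism :: "('v \<Rightarrow> 'w) \<Rightarrow> ('v, 'm) frame \<Rightarrow> ('w, 'm) frame \<Rightarrow> bool" where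
  "p_morphism f F F' \<longleftrightarrow> f ` worlds F \<subseteq> worlds F' \<and>
    (\<forall>m. \<forall>x\<in>worlds F. \<forall>y\<in>worlds F. (x, y) \<in> acc F m \<longrightarrow> (f x, f y) \<in> acc F' m) \<and>
    (\<forall>m. \<forall>x\<in>worlds F. \<forall>y'\<in>worlds F'. (f x, y') \<in> acc F' m \<longrightarrow> (\<exists>y\<in>worlds F. (x, y) \<in> acc F m \<and> f y = y'))"

lemma p_morphism_sat:
  assumes "p_morphism f F F'" "x \<in> worlds F"
  shows "sat F (\<lambda>i. f -` V i) x \<phi> \<longleftrightarrow> sat F' V (f x) \<phi>"
  using assms(2)
proof (induction \<phi> arbitrary: x)
  case (Dia m \<phi>)
  show ?case
  proof
    assume "sat F (\<lambda>i. f -` V i) x (Dia m \<phi>)"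
    then obtain y where "y \<in> worlds F" "(x, y) \<in> acc F m" "sat F' V (f y) \<phi>"
      using Dia.IH by auto
    moreover from this have "f y \<in> worlds F'" "(f x, f y) \<in> acc F' m"
      using assms(1) Dia.prems unfolding p_morphism_def by blast+
    ultimately show "sat F' V (f x) (Dia m \<phi>)" by auto
  next
    assume "sat F' V (f x) (Dia m \<phi>)"
    then obtain y' where y': "y' \<in> worlds F'" "(f x, y') \<in> acc F' m" "sat F' V y' \<phi>" by auto
    then obtain y where "y \<in> worlds F" "(x, y) \<in> acc F m" "f y = y'"
      using assms(1) Dia.prems unfolding p_morphism_def by blast
    then show "sat F (\<lambda>i. f -` V i) x (Dia m \<phi>)"
      using Dia.IH y' by auto
  qed
qed auto

section \<open>Skolem terms and the countable hull\<close>

instance fm :: (countable) countable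
  by countable_datatype

instance modality :: countable
  by countable_datatype

text \<open>\<open>Wit\<close> names a witness of a diamond. \<open>Mid\<close> names a point
  between two given ones along two modalities, which preserves commutation in the hull.\<close>

datatype 'm skolem =
    Root
  | Wit 'm "'m fm" "'m skolem"
  | Mid 'm 'm "'m skolem" "'m skolem"

instance skolem :: (countable) countable
  by countable_datatype

text \<open>The default keeps the hull within the worlds when a term asks for a witness that does
  not exist.\<close>

definition pick :: "'a \<Rightarrow> ('a \<Rightarrow> bool) \<Rightarrow> 'a" where
  "pick d P = (if \<exists>w. P w then SOME w. P w else d)"

lemma pickI: "P w \<Longrightarrow> P (pick d P)"
  unfolding pick_def by (auto intro: someI)

lemma pick_cases: "P (pick d P) \<or> pick d P = d"
  using pickI by (metis pick_def)

context normal_logic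
begin

primrec hull :: "'m fm set \<Rightarrow> 'm skolem \<Rightarrow> 'm fm set" where
  "hull x0 Root = x0"
| "hull x0 (Wit m \<phi> a) = pick (hull x0 a) (\<lambda>y. can m (hull x0 a) y \<and> \<phi> \<in> y)"
| "hull x0 (Mid m k a b) = pick (hull x0 a) (\<lambda>w. can m (hull x0 a) w \<and> can k w (hull x0 b))"

lemma world_hull:
  assumes "world x0"
  shows "world (hull x0 a)"
proof (induction a)
  case (Wit m \<phi> a)
  then show ?case
    using pick_cases[of "\<lambda>y. can m (hull x0 a) y \<and> \<phi> \<in> y" "hull x0 a"] can_world by auto
next
  case (Mid m k a b)
  then show ?case
    using pick_cases[of "\<lambda>w. can m (hull x0 a) w \<and> can k w (hull x0 b)" "hull x0 a"] can_world by auto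
qed (use assms in simp)

lemma hull_Wit:
  assumes "world x0" "x \<in> range (hull x0)" "Dia m \<phi> \<in> x"
  shows "\<exists>y\<in>range (hull x0). can m x y \<and> \<phi> \<in> y"
proof -
  obtain a where a: "x = hull x0 a" using assms(2) by blast
  obtain y where "can m x y \<and> \<phi> \<in> y"
    using assms a world_hull truth_Dia by blast
  then have "can m x (hull x0 (Wit m \<phi> a)) \<and> \<phi> \<in> hull x0 (Wit m \<phi> a)"
    unfolding a hull.simps by (rule pickI[where P = "\<lambda>y. can m (hull x0 a) y \<and> \<phi> \<in> y"])
  then show ?thesis by blast
qed

lemma hull_Mid:
  assumes "x \<in> range (hull x0)" "z \<in> range (hull x0)" "can m x w" "can k w z"
  shows "\<exists>w\<in>range (hull x0). can m x w \<and> can k w z"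
proof -
  obtain a b where ab: "x = hull x0 a" "z = hull x0 b" using assms(1,2) by blast
  have "can m x (hull x0 (Mid m k a b)) \<and> can k (hull x0 (Mid m k a b)) z"
    unfolding ab hull.simps
    by (rule pickI[where P = "\<lambda>w. can m (hull x0 a) w \<and> can k w (hull x0 b)"]) (use assms(3,4) ab in blast)
  then show ?thesis by blast
qed

definition hull_frame :: "'m fm set \<Rightarrow> ('m fm set, 'm) frame" where
  "hull_frame x0 = \<lparr>worlds = range (hull x0),
     acc = \<lambda>m. {(x, y). x \<in> range (hull x0) \<and> y \<in> range (hull x0) \<and> can m x y}\<rparr>"

text \<open>Closure under \<open>Wit\<close> is the Tarski-Vaught condition under which the truth
  lemma passes to the submodel.\<close>

lemma sat_hull_frame:
  assumes "world x0" "x \<in> range (hull x0)"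
  shows "sat (hull_frame x0) (\<lambda>i. {y. Var i \<in> y}) x \<phi> \<longleftrightarrow> \<phi> \<in> x"
  using assms(2)
proof (induction \<phi> arbitrary: x)
  case (Dia m \<phi>)
  then have "world x" using world_hull[OF assms(1)] by blast
  then show ?case
    using Dia hull_Wit[OF assms(1) Dia.prems] truth_Dia
    by (simp add: hull_frame_def) blast
qed (use world_hull[OF assms(1)] in \<open>auto simp: hull_frame_def\<close>)

end

section \<open>Clean frames as images of products\<close>

text \<open>\<open>N\<close> is enumerated by pairs, and the pair \<open>(i, j)\<close> is sent to
  the \<open>i\<close>-th element of \<open>A\<close>; varying \<open>j\<close> gives infinitely
  many preimages.\<close>

lemma infinite_fibres:
  fixes N :: "nat set"
  assumes "infinite N" "countable A" "A \<noteq> {}"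
  shows "\<exists>g. (\<forall>u. g u \<in> A) \<and> (\<forall>y\<in>A. infinite {u \<in> N. g u = y})"
proof -
  have "bij_betw (from_nat_into N) UNIV N"
    using assms(1) by (intro bij_betw_from_nat_into) simp_all
  then have e: "inj (from_nat_into N)" "\<And>j. from_nat_into N j \<in> N"
    by (auto simp: bij_betw_def)
  define g where "g u = from_nat_into A (fst (prod_decode (inv (from_nat_into N) u)))" for u
  have "infinite {u \<in> N. g u = y}" if "y \<in> A" for y
  proof -
    obtain i where i: "from_nat_into A i = y"
      using from_nat_into_surj[OF assms(2) \<open>y \<in> A\<close>] by blast
    let ?f = "\<lambda>j. from_nat_into N (prod_encode (i, j))"
    have "range ?f \<subseteq> {u \<in> N. g u = y}"
      using e(2) i by (auto simp: g_def inv_f_f[OF e(1)])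
    moreover have "inj ?f"
      by (simp add: inj_on_def inj_eq[OF e(1)])
    ultimately show ?thesis
      using finite_imageD[of ?f UNIV] finite_subset infinite_UNIV_nat by blast
  qed
  moreover have "g u \<in> A" for u
    unfolding g_def by (rule from_nat_into[OF assms(3)])
  ultimately show ?thesis by blast
qed

text \<open>Formulae are left behind here. The commutation witnesses have to lie in
  \<open>X\<close>, which is what the \<open>Mid\<close> terms provide.\<close>

locale clean_frame =
  fixes X :: "'w set" and R E :: "'w \<Rightarrow> 'w \<Rightarrow> bool" and n :: nat
  assumes countable_X: "countable X"
    and R_refl: "x \<in> X \<Longrightarrow> R x x"
    and R_trans: "R x y \<Longrightarrow> R y z \<Longrightarrow> R x z"
    and R_antisym: "R x y \<Longrightarrow> R y x \<Longrightarrow> x = y"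
    and E_refl: "x \<in> X \<Longrightarrow> E x x"
    and E_sym: "E x y \<Longrightarrow> E y x"
    and E_trans: "E x y \<Longrightarrow> E y z \<Longrightarrow> E x z"
    and E_R_commute: "x \<in> X \<Longrightarrow> y \<in> X \<Longrightarrow> z \<in> X \<Longrightarrow> E x y \<Longrightarrow> R y z \<Longrightarrow> \<exists>w\<in>X. R x w \<and> E w z"
    and R_E_commute: "x \<in> X \<Longrightarrow> y \<in> X \<Longrightarrow> z \<in> X \<Longrightarrow> R x y \<Longrightarrow> E y z \<Longrightarrow> \<exists>w\<in>X. E x w \<and> R w z"
    and clean: "R x y \<Longrightarrow> E x y \<Longrightarrow> x = y"
    and depth: "x \<in> X \<Longrightarrow> \<not> strict_chain R n x"
    and n_pos: "n \<ge> 1"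
begin

text \<open>Infinite fibres leave enough room to prescribe a value at one index while still covering a
  whole \<open>E\<close>-class.\<close>

definition class_map :: "(nat \<Rightarrow> 'w) \<Rightarrow> bool" where
  "class_map h \<longleftrightarrow> (\<forall>u. h u \<in> X) \<and> (\<forall>u v. E (h u) (h v)) \<and> (\<forall>u. \<forall>y\<in>X. E (h u) y \<longrightarrow> infinite {v. h v = y})"

lemma class_map_exists:
  assumes "x \<in> X"
  obtains h u where "class_map h" "h u = x"
proof -
  have "countable {y \<in> X. E x y}" "{y \<in> X. E x y} \<noteq> {}"
    using countable_X E_refl[OF assms] assms by auto
  then obtain h :: "nat \<Rightarrow> 'w" where h: "\<And>u. h u \<in> X \<and> E x (h u)" "\<And>y. y \<in> X \<Longrightarrow> E x y \<Longrightarrow> infinite {u. h u = y}"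
    using infinite_fibres[OF infinite_UNIV_nat, of "{y \<in> X. E x y}"] by auto
  then have "class_map h"
    unfolding class_map_def using E_sym E_trans by blast
  moreover obtain u where "h u = x"
    using h(2)[OF assms E_refl[OF assms]] by (metis (mono_tags) finite.emptyI Collect_empty_eq)
  ultimately show thesis using that by blast
qed

text \<open>Each fibre of \<open>h\<close> over \<open>x\<close> is spread, with infinite fibres,
  over the points \<open>A x\<close> of the class of \<open>y\<close> above \<open>x\<close>.
  \<open>E_R_commute\<close> makes \<open>A x\<close> nonempty, and \<open>R_E_commute\<close>
  places every point of the new class in some \<open>A x\<close>. Only the index \<open>w\<close> is
  then redirected to \<open>y\<close>.\<close>

lemma class_map_step:
  assumes h: "class_map h" and y: "y \<in> X" "R (h w) y"
  shows "\<exists>h'. class_map h' \<and> h' w = y \<and> (\<forall>u. R (h u) (h' u))"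
proof -
  define A where "A x = {d \<in> X. E y d \<and> R x d}" for x
  have "\<exists>g. (\<forall>u. g u \<in> A x) \<and> (\<forall>d\<in>A x. infinite {u \<in> {u. h u = x}. g u = d})" if x: "x \<in> X" "E (h w) x" for x
  proof (rule infinite_fibres)
    show "infinite {u. h u = x}" using h x by (auto simp: class_map_def)
    show "countable (A x)" using countable_X by (auto simp: A_def)
    show "A x \<noteq> {}"
      using E_R_commute[OF x(1) _ y(1) E_sym[OF x(2)] y(2)] h E_sym by (auto simp: A_def class_map_def)
  qed
  then obtain g where g: "\<And>x u. x \<in> X \<Longrightarrow> E (h w) x \<Longrightarrow> g x u \<in> A x"
    "\<And>x d. x \<in> X \<Longrightarrow> E (h w) x \<Longrightarrow> d \<in> A x \<Longrightarrow> infinite {u. h u = x \<and> g x u = d}"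
    by simp metis
  define h' where "h' u = (if u = w then y else g (h u) u)" for u
  have hX: "h u \<in> X" "E (h w) (h u)" for u
    using h by (auto simp: class_map_def)
  have h'A: "h' u \<in> A (h u)" for u
    using g(1)[OF hX] y E_refl by (auto simp: h'_def A_def)
  have "infinite {u. h' u = d}" if d: "d \<in> X" "E y d" for d
  proof -
    obtain x where x: "x \<in> X" "E (h w) x" "R x d"
      using R_E_commute[OF hX(1) y(1) d(1) y(2) d(2)] by blast
    then have "infinite {u. h u = x \<and> g x u = d}"
      using g(2) d by (simp add: A_def)
    \<comment> \<open>Redirecting \<open>w\<close> costs a fibre at most one index.\<close>
    then have "infinite ({u. h u = x \<and> g x u = d} - {w})" by simp
    moreover have "{u. h u = x \<and> g x u = d} - {w} \<subseteq> {u. h' u = d}"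
      by (auto simp: h'_def)
    ultimately show ?thesis using finite_subset by blast
  qed
  then have "class_map h'"
    using h'A E_sym E_trans unfolding class_map_def A_def by blast
  moreover have "h' w = y" "\<forall>u. R (h u) (h' u)"
    using h'A by (auto simp: h'_def A_def)
  ultimately show ?thesis by blast
qed

text \<open>The tree of the first factor: a node records, last move first, the pairs \<open>(w, y)\<close> by which
  the value at index \<open>w\<close> was moved strictly up to \<open>y\<close>.\<close>

primrec map_at :: "(nat \<Rightarrow> 'w) \<Rightarrow> (nat \<times> 'w) list \<Rightarrow> nat \<Rightarrow> 'w" where
  "map_at h [] = h"
| "map_at h (e # l) = (SOME h'. class_map h' \<and> h' (fst e) = snd e \<and> (\<forall>u. R (map_at h l u) (h' u)))"

primrec node :: "(nat \<Rightarrow> 'w) \<Rightarrow> (nat \<times> 'w) list \<Rightarrow> bool" where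
  "node h [] \<longleftrightarrow> True"
| "node h (e # l) \<longleftrightarrow> node h l \<and> snd e \<in> X \<and> R (map_at h l (fst e)) (snd e) \<and> map_at h l (fst e) \<noteq> snd e"

text \<open>Along a \<open>node\<close>, \<open>class_map_step\<close> provides the object chosen by
  \<open>SOME\<close> in \<open>map_at\<close>.\<close>

lemma class_map_at:
  assumes "class_map h" "node h l"
  shows "class_map (map_at h l)"
    and "l = e # l' \<Longrightarrow> map_at h l (fst e) = snd e \<and> (\<forall>u. R (map_at h l' u) (map_at h l u))"
proof -
  have "class_map (map_at h l) \<and>
      (\<forall>e l'. l = e # l' \<longrightarrow> map_at h l (fst e) = snd e \<and> (\<forall>u. R (map_at h l' u) (map_at h l u)))"
    using assms(2)
  proof (induction l)
    case (Cons e l)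
    have "\<exists>h'. class_map h' \<and> h' (fst e) = snd e \<and> (\<forall>u. R (map_at h l u) (h' u))"
      using class_map_step Cons by simp
    then show ?case
      using someI_ex[where P = "\<lambda>h'. class_map h' \<and> h' (fst e) = snd e \<and> (\<forall>u. R (map_at h l u) (h' u))"]
      by simp
  qed (use assms(1) in simp)
  then show "class_map (map_at h l)"
    and "l = e # l' \<Longrightarrow> map_at h l (fst e) = snd e \<and> (\<forall>u. R (map_at h l' u) (map_at h l u))"
    by blast+
qed

lemma map_at_mono:
  assumes h: "class_map h" and "node h l" "suffix m l"
  shows "R (map_at h m u) (map_at h l u)"
  using assms(2,3)
proof (induction l)
  case Nil
  then show ?case using R_refl h by (simp add: class_map_def)
next
  case (Cons e l)
  have "R (map_at h l u) (map_at h (e # l) u)"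
    using class_map_at(2)[OF h Cons.prems(1)] by blast
  moreover have "R (map_at h (e # l) u) (map_at h (e # l) u)"
    using class_map_at(1)[OF h Cons.prems(1)] R_refl by (simp add: class_map_def)
  ultimately show ?case
    using Cons R_trans by (auto simp: suffix_Cons simp del: map_at.simps)
qed

text \<open>A move is strict at its own index, hence by cleanness at every index.\<close>

lemma map_at_strict:
  assumes h: "class_map h" and l: "node h l" "suffix m l" "m \<noteq> l"
  shows "\<not> R (map_at h l u) (map_at h m u)"
  using l
proof (induction l)
  case (Cons e l)
  have up: "R (map_at h l v) (map_at h (e # l) v)" for v
    using class_map_at(2)[OF h Cons.prems(1)] by blast
  have ml: "suffix m l" "node h l"
    using Cons.prems by (auto simp: suffix_Cons)
  have m: "R (map_at h m v) (map_at h l v)" for v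
    using map_at_mono[OF h ml(2,1)] .
  show ?case
  proof
    assume "R (map_at h (e # l) u) (map_at h m u)"
    then have "map_at h (e # l) u = map_at h l u"
      using up m R_trans R_antisym by meson
    \<comment> \<open>Agreement at one index puts both maps into the same \<open>E\<close>-class, so
      cleanness also applies at the index of the move.\<close>
    then have "E (map_at h l (fst e)) (map_at h (e # l) (fst e))"
      using class_map_at(1)[OF h Cons.prems(1)] class_map_at(1)[OF h ml(2)] E_trans
      unfolding class_map_def by metis
    then have "map_at h l (fst e) = map_at h (e # l) (fst e)"
      using clean up by blast
    then show False
      using class_map_at(2)[OF h Cons.prems(1)] Cons.prems(1) by auto
  qed
qed simp

text \<open>The nodes, ordered by \<open>suffix\<close> and coded in \<open>'a\<close>, form the
  first factor; the indices, coded in \<open>'b\<close> with the universal relation, form the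
  second. \<open>f\<close> evaluates the map of the node at the index. The back condition for
  \<open>\<diamond>\<close> adds a move; for \<open>\<exists>\<close> it uses that the map covers
  its class.\<close>

lemma clean_frame_product_image:
  assumes "infinite (UNIV :: 'a set)" "infinite (UNIV :: 'b set)" "x \<in> X"
  obtains F :: "('a, unit) frame" and G :: "('b, unit) frame" and f r where
    "logic_frame (Grz_depth n) F" "S5_frame G" "r \<in> worlds (product_frame F G)" "f r = x"
    "p_morphism f (product_frame F G) \<lparr>worlds = X, acc = \<lambda>m. {(x, y). x \<in> X \<and> y \<in> X \<and>
       (case m of DiaM \<Rightarrow> R x y | ExM \<Rightarrow> E x y)}\<rparr>"
proof -
  obtain h u0 where h: "class_map h" and u0: "h u0 = x"
    using class_map_exists[OF assms(3)] .
  define N where "N = {l. node h l}"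
  have "set l \<subseteq> UNIV \<times> X" if "node h l" for l
    using that by (induction l) auto
  then have "N \<subseteq> lists (UNIV \<times> X)"
    by (auto simp: N_def in_lists_conv_set)
  then have "countable N"
    using countable_subset countable_X by (metis countable_SIGMA countable_lists countableI_type)
  then obtain c :: "(nat \<times> 'w) list \<Rightarrow> nat" where c: "inj_on c N"
    by (auto simp: countable_def)
  obtain ja :: "nat \<Rightarrow> 'a" where ja: "inj ja"
    using infinite_countable_subset[OF assms(1)] by blast
  obtain jb :: "nat \<Rightarrow> 'b" where jb: "inj jb"
    using infinite_countable_subset[OF assms(2)] by blast
  define k where "k = inv_into N (ja \<circ> c)"
  have inj: "inj_on (ja \<circ> c) N"
    using c ja by (metis comp_inj_on inj_on_subset subset_UNIV)
  define A where "A = (ja \<circ> c) ` N"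
  have kN: "a \<in> A \<Longrightarrow> node h (k a)" for a
    unfolding A_def k_def using inv_into_into[of a "ja \<circ> c" N] by (simp add: N_def)
  have k_inj: "a \<in> A \<Longrightarrow> b \<in> A \<Longrightarrow> k a = k b \<Longrightarrow> a = b" for a b
    unfolding A_def k_def using inv_into_injective by metis
  have k_surj: "\<exists>a\<in>A. k a = l" if "node h l" for l
    using that inj unfolding A_def k_def by (intro bexI[of _ "(ja \<circ> c) l"]) (auto simp: N_def inv_into_f_f simp del: o_apply)
  define F :: "('a, unit) frame" where
    "F = \<lparr>worlds = A, acc = \<lambda>_. {(a, b). a \<in> A \<and> b \<in> A \<and> suffix (k a) (k b)}\<rparr>"
  define G :: "('b, unit) frame" where
    "G = \<lparr>worlds = range jb, acc = \<lambda>_. range jb \<times> range jb\<rparr>"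
  define f where "f = (\<lambda>(a, b). map_at h (k a) (inv jb b))"
  have F_sel: "worlds F = A" "(a, b) \<in> acc F i \<longleftrightarrow> a \<in> A \<and> b \<in> A \<and> suffix (k a) (k b)" for a b i
    by (auto simp: F_def)
  have G_sel: "worlds G = range jb" "(a, b) \<in> acc G i \<longleftrightarrow> a \<in> range jb \<and> b \<in> range jb" for a b i
    by (auto simp: G_def)
  have A_ne: "A \<noteq> {}" using k_surj[of "[]"] by auto
  have fX: "map_at h (k a) u \<in> X" "E (map_at h (k a) u) (map_at h (k a) v)" if "a \<in> A" for a u v
    using class_map_at(1)[OF h kN[OF that]] by (auto simp: class_map_def)
  \<comment> \<open>Any index would do in place of \<open>0\<close>, since moves are strict at all
    of them.\<close>
  have chain: "strict_chain R j (map_at h (k a) 0)"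
    if "strict_chain (\<lambda>x y. (x, y) \<in> acc F ()) j a" for j a
    using that
  proof (induction j arbitrary: a)
    case (Suc j)
    then obtain b where b: "a \<in> A" "b \<in> A" "suffix (k a) (k b)" "\<not> suffix (k b) (k a)"
      "strict_chain R j (map_at h (k b) 0)"
      by (auto simp: F_sel)
    then have "R (map_at h (k a) 0) (map_at h (k b) 0)" "\<not> R (map_at h (k b) 0) (map_at h (k a) 0)"
      using map_at_mono[OF h kN] map_at_strict[OF h kN, of b "k a"] by auto
    then show ?case using b by auto
  qed simp
  have "logic_frame (Grz_depth n) F"
  proof (rule logic_frame_Grz_depthI)
    show "is_frame F"
      using A_ne by (auto simp: is_frame_def F_sel)
    show "partial_order_on (worlds F) (acc F ())"
      unfolding partial_order_on_def preorder_on_def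
      by (auto simp: F_sel refl_on_def trans_def antisym_def k_inj dest: suffix_order.order_trans suffix_order.antisym)
    show "\<not> strict_chain (\<lambda>x y. (x, y) \<in> acc F ()) n a" if "a \<in> worlds F" for a
      using chain depth fX(1) that unfolding F_sel(1) by blast
  qed (rule n_pos)
  moreover have "S5_frame G"
    by (auto simp: S5_frame_def is_frame_def G_sel equiv_def refl_on_def sym_def trans_def)
  moreover obtain a0 where "a0 \<in> A" "k a0 = []"
    using k_surj[of "[]"] by auto
  then have "(a0, jb u0) \<in> worlds (product_frame F G)" "f (a0, jb u0) = x"
    using u0 jb by (simp_all add: F_sel G_sel f_def)
  moreover have "p_morphism f (product_frame F G) \<lparr>worlds = X, acc = \<lambda>m. {(x, y). x \<in> X \<and> y \<in> X \<and>
       (case m of DiaM \<Rightarrow> R x y | ExM \<Rightarrow> E x y)}\<rparr>" (is "p_morphism _ ?P ?F")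
    unfolding p_morphism_def
  proof (intro conjI allI ballI impI)
    show "f ` worlds ?P \<subseteq> worlds ?F"
      using fX by (auto simp: F_sel f_def)
  next
    fix m x y assume "x \<in> worlds ?P" "y \<in> worlds ?P" "(x, y) \<in> acc ?P m"
    then show "(f x, f y) \<in> acc ?F m"
      using fX map_at_mono[OF h kN]
      by (cases m; cases x; cases y) (auto simp: F_sel G_sel f_def)
  next
    fix m x y' assume *: "x \<in> worlds ?P" "y' \<in> worlds ?F" "(f x, y') \<in> acc ?F m"
    obtain a u where x: "x = (a, jb u)" "a \<in> A"
      using *(1) by (auto simp: F_sel G_sel)
    then have f: "f x = map_at h (k a) u"
      using jb by (simp add: f_def)
    show "\<exists>y\<in>worlds ?P. (x, y) \<in> acc ?P m \<and> f y = y'"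
    proof (cases m)
      case DiaM
      show ?thesis
      proof (cases "f x = y'")
        case True
        then show ?thesis
          using x DiaM by (intro bexI[of _ x]) (auto simp: F_sel G_sel)
      next
        case False
        \<comment> \<open>The child that moves index \<open>u\<close> to \<open>y'\<close> is a node
          because \<open>y'\<close> lies strictly above the current value.\<close>
        let ?l = "(u, y') # k a"
        have l: "node h ?l"
          using False * DiaM f kN[OF x(2)] by simp
        then obtain b where b: "b \<in> A" "k b = ?l"
          using k_surj by blast
        have "f (b, jb u) = y'"
          using class_map_at(2)[OF h l refl] b(2) jb by (simp add: f_def del: map_at.simps)
        then show ?thesis
          using x b DiaM by (intro bexI[of _ "(b, jb u)"]) (auto simp: F_sel G_sel suffix_Cons)
      qed
    next
      case ExM
      then have "infinite {v. map_at h (k a) v = y'}"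
        using class_map_at(1)[OF h kN[OF x(2)]] * f by (auto simp: class_map_def)
      then obtain v where "map_at h (k a) v = y'"
        using not_finite_existsD by blast
      then show ?thesis
        using x ExM jb by (intro bexI[of _ "(a, jb v)"]) (auto simp: F_sel G_sel f_def)
    qed
  qed
  ultimately show thesis
    using that by blast
qed

end

text \<open>A world omitting \<open>\<phi>\<close> is made the root of a hull, and the refutation is
  pulled back along the p-morphism.\<close>

lemma (in casari_logic) refuted_in_product:
  assumes "infinite (UNIV :: 'a set)" "infinite (UNIV :: 'b set)" "\<phi> \<notin> L"
  obtains F :: "('a, unit) frame" and G :: "('b, unit) frame" where
    "logic_frame (Grz_depth n) F" "S5_frame G" "\<not> valid (product_frame F G) \<phi>"
proof -
  obtain x0 where x0: "world x0" "\<phi> \<notin> x0"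
    using lindenbaum[OF theory_L assms(3)] by blast
  let ?X = "range (hull x0)"
  have w: "world x" if "x \<in> ?X" for x
    using that world_hull[OF x0(1)] by blast
  interpret clean_frame ?X R E n
  proof
    show "\<exists>w\<in>?X. R x w \<and> E w z" if "x \<in> ?X" "z \<in> ?X" "E x y" "R y z" for x y z
      using E_R_commute[OF that(3,4)] hull_Mid[OF that(1,2)] by metis
    show "\<exists>w\<in>?X. E x w \<and> R w z" if "x \<in> ?X" "z \<in> ?X" "R x y" "E y z" for x y z
      using R_E_commute[OF that(3,4)] hull_Mid[OF that(1,2)] by metis
    show "x = y" if "R x y" "E x y" for x y
      using R_clean[OF that(1) E_Q[OF E_sym[OF that(2)]]] .
    show "\<not> strict_chain R n x" if "x \<in> ?X" for x
      using R_depth w that by blast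
    show "R x x" "E x x" if "x \<in> ?X" for x
      using R_refl E_refl w[OF that] by blast+
  qed (fact R_trans R_antisym E_sym E_trans n_pos countable_image[OF countableI_type])+
  have "x0 \<in> ?X"
    using rangeI[of "hull x0" Root] unfolding hull.simps .
  have "(case m of DiaM \<Rightarrow> R x y | ExM \<Rightarrow> E x y) = can m x y" for m x y
    by (cases m) simp_all
  then have frame: "\<lparr>worlds = ?X, acc = \<lambda>m. {(x, y). x \<in> ?X \<and> y \<in> ?X \<and> (case m of DiaM \<Rightarrow> R x y | ExM \<Rightarrow> E x y)}\<rparr>
      = hull_frame x0"
    unfolding hull_frame_def by simp
  obtain F :: "('a, unit) frame" and G :: "('b, unit) frame" and f r where
    FG: "logic_frame (Grz_depth n) F" "S5_frame G" and r: "r \<in> worlds (product_frame F G)" "f r = x0"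
    and f: "p_morphism f (product_frame F G) (hull_frame x0)"
    using clean_frame_product_image[OF assms(1,2) \<open>x0 \<in> ?X\<close>, unfolded frame] .
  have "\<not> sat (product_frame F G) (\<lambda>i. f -` {y. Var i \<in> y}) r \<phi>"
    unfolding p_morphism_sat[OF f r(1)] r(2) sat_hull_frame[OF x0(1) \<open>x0 \<in> ?X\<close>] by (rule x0(2))
  then show thesis
    using that FG r(1) unfolding valid_def by blast
qed

section \<open>The axiomatic system\<close>

text \<open>Tautologies enter the logics only through the unimodal \<open>K\<close>. Replacing each
  propositional atom by the variable coding it gives a diamond-free unimodal tautology, from which
  substitution along \<open>from_nat\<close> recovers the formula.\<close>

lemma tautology_in_extension:
  fixes \<phi> :: "'m::countable fm" and L :: "'m fm set"
  assumes "\<phi> \<in> tautologies" and K: "\<And>\<psi>. \<psi> \<in> K \<Longrightarrow> map_fm (\<lambda>_. m) \<psi> \<in> L"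
    and sub: "\<And>\<psi> \<sigma>. \<psi> \<in> L \<Longrightarrow> subst \<sigma> \<psi> \<in> L"
  shows "\<phi> \<in> L"
proof -
  define skeleton :: "'m fm \<Rightarrow> unit fm" where
    "skeleton = rec_fm (\<lambda>i. Var (to_nat (Var i :: 'm fm))) Fls (\<lambda>_ _ a b. a \<^bold>\<rightarrow> b) (\<lambda>m \<psi> _. Var (to_nat (Dia m \<psi>)))"
  have "prop_eval e (skeleton \<psi>) \<longleftrightarrow> prop_eval (\<lambda>\<chi>. e (Var (to_nat \<chi>))) \<psi>" for e \<psi>
    by (induction \<psi>) (auto simp: skeleton_def)
  then have "skeleton \<phi> \<in> tautologies"
    using assms(1) by (simp add: tautologies_def)
  then have "skeleton \<phi> \<in> K"
    unfolding K_def by (rule extension.base)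
  moreover have "subst from_nat (map_fm (\<lambda>_. m) (skeleton \<psi>)) = \<psi>" for \<psi>
    by (induction \<psi>) (auto simp: skeleton_def)
  ultimately show ?thesis
    using sub[OF K] by metis
qed

text \<open>The schemes are substitution instances of the axioms; those of \<open>K\<close> are
  available for both modalities because \<open>Grz\<close> and \<open>S5\<close> both extend
  \<open>K\<close>.\<close>

lemma casari_logic_MplusGrzB_depth:
  assumes "n \<ge> 1"
  shows "casari_logic (MplusGrzB_depth n) n"
proof -
  let ?L = "MplusGrzB_depth n"
  let ?p = "Var 0 :: unit fm" and ?q = "Var 1 :: unit fm"
  have sub: "subst \<sigma> \<phi> \<in> ?L" if "\<phi> \<in> ?L" for \<phi> \<sigma>
    using that unfolding MplusGrzB_depth_def by (rule extension.sub)
  have fus: "\<phi> \<in> ?L" if "\<phi> \<in> fusion Grz S5" for \<phi>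
    using that unfolding MplusGrzB_depth_def MplusGrzB_def MGrzB_def by (intro extension.base)
  have G: "map_fm (\<lambda>_. DiaM) \<phi> \<in> ?L" if "\<phi> \<in> Grz" for \<phi>
    using that by (intro fus) (auto simp: fusion_def intro: extension.base)
  have S: "map_fm (\<lambda>_. ExM) \<phi> \<in> ?L" if "\<phi> \<in> S5" for \<phi>
    using that by (intro fus) (auto simp: fusion_def intro: extension.ax)
  have K: "map_fm (\<lambda>_. m) \<phi> \<in> ?L" if "\<phi> \<in> K" for m \<phi>
    using that G[of \<phi>] S[of \<phi>] by (cases m) (auto simp: Grz_def S5_def intro: extension.base)
  have inst: "map_fm (\<lambda>_. m) \<phi> \<in> ?L \<Longrightarrow> subst \<sigma> (map_fm (\<lambda>_. m) \<phi>) \<in> ?L" for m \<sigma> \<phi>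
    by (rule sub)
  have Kax: "Box () (?p \<^bold>\<rightarrow> ?q) \<^bold>\<rightarrow> Box () ?p \<^bold>\<rightarrow> Box () ?q \<in> K"
    "Dia () ?p \<^bold>\<rightarrow> \<^bold>\<not> (Box () (\<^bold>\<not> ?p)) \<in> K" "\<^bold>\<not> (Box () (\<^bold>\<not> ?p)) \<^bold>\<rightarrow> Dia () ?p \<in> K"
    unfolding K_def by (rule extension.ax, simp)+
  have Gax: "Box () (Box () (?p \<^bold>\<rightarrow> Box () ?p) \<^bold>\<rightarrow> ?p) \<^bold>\<rightarrow> ?p \<in> Grz"
    unfolding Grz_def by (rule extension.ax) simp
  have Sax: "?p \<^bold>\<rightarrow> Dia () ?p \<in> S5" "Dia () (Dia () ?p) \<^bold>\<rightarrow> Dia () ?p \<in> S5" "?p \<^bold>\<rightarrow> Box () (Dia () ?p) \<in> S5"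
    unfolding S5_def by (rule extension.ax, simp)+
  have ax: "\<^bold>\<exists> \<^bold>\<diamond> (Var 0) \<^bold>\<rightarrow> \<^bold>\<diamond> \<^bold>\<exists> (Var 0) \<in> ?L" "\<^bold>\<diamond> \<^bold>\<exists> (Var 0) \<^bold>\<rightarrow> \<^bold>\<exists> \<^bold>\<diamond> (Var 0) \<in> ?L"
    "\<^bold>\<box> \<^bold>\<forall> (\<^bold>\<box> (\<^bold>\<box> (Var 0) \<^bold>\<rightarrow> \<^bold>\<box> \<^bold>\<forall> (Var 0)) \<^bold>\<rightarrow> \<^bold>\<box> \<^bold>\<forall> (Var 0)) \<^bold>\<rightarrow> \<^bold>\<box> \<^bold>\<forall> (Var 0) \<in> ?L" "bd DiaM n \<in> ?L"
    unfolding MplusGrzB_depth_def MplusGrzB_def MGrzB_def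
    by (blast intro: extension.base extension.ax)+
  show ?thesis
  proof unfold_locales
    fix \<phi> :: "modality fm" assume "\<phi> \<in> tautologies"
    then show "\<phi> \<in> ?L"
      using K sub by (rule tautology_in_extension)
  next
    fix \<phi> \<psi> assume "\<phi> \<^bold>\<rightarrow> \<psi> \<in> ?L" "\<phi> \<in> ?L"
    then show "\<psi> \<in> ?L"
      unfolding MplusGrzB_depth_def by (rule extension.mp)
  next
    fix \<phi> m assume "\<phi> \<in> ?L"
    then show "Box m \<phi> \<in> ?L"
      unfolding MplusGrzB_depth_def by (rule extension.nec)
  next
    fix m \<phi> \<psi>
    show "Box m (\<phi> \<^bold>\<rightarrow> \<psi>) \<^bold>\<rightarrow> Box m \<phi> \<^bold>\<rightarrow> Box m \<psi> \<in> ?L"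
      using inst[OF K[OF Kax(1)], of "\<lambda>i. if i = 0 then \<phi> else \<psi>"] by simp
    show "Dia m \<phi> \<^bold>\<rightarrow> \<^bold>\<not> (Box m (\<^bold>\<not> \<phi>)) \<in> ?L"
      using inst[OF K[OF Kax(2)], of "\<lambda>_. \<phi>"] by simp
    show "\<^bold>\<not> (Box m (\<^bold>\<not> \<phi>)) \<^bold>\<rightarrow> Dia m \<phi> \<in> ?L"
      using inst[OF K[OF Kax(3)], of "\<lambda>_. \<phi>"] by simp
  next
    fix p
    show "\<^bold>\<box> (\<^bold>\<box> (p \<^bold>\<rightarrow> \<^bold>\<box> p) \<^bold>\<rightarrow> p) \<^bold>\<rightarrow> p \<in> ?L"
      using inst[OF G[OF Gax], of "\<lambda>_. p"] by simp
    show "p \<^bold>\<rightarrow> \<^bold>\<exists> p \<in> ?L"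
      using inst[OF S[OF Sax(1)], of "\<lambda>_. p"] by simp
    show "\<^bold>\<exists> \<^bold>\<exists> p \<^bold>\<rightarrow> \<^bold>\<exists> p \<in> ?L"
      using inst[OF S[OF Sax(2)], of "\<lambda>_. p"] by simp
    show "p \<^bold>\<rightarrow> \<^bold>\<forall> \<^bold>\<exists> p \<in> ?L"
      using inst[OF S[OF Sax(3)], of "\<lambda>_. p"] by simp
    show "\<^bold>\<exists> \<^bold>\<diamond> p \<^bold>\<rightarrow> \<^bold>\<diamond> \<^bold>\<exists> p \<in> ?L"
      using sub[OF ax(1), of "\<lambda>_. p"] by simp
    show "\<^bold>\<diamond> \<^bold>\<exists> p \<^bold>\<rightarrow> \<^bold>\<exists> \<^bold>\<diamond> p \<in> ?L"
      using sub[OF ax(2), of "\<lambda>_. p"] by simp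
    show "\<^bold>\<box> \<^bold>\<forall> (\<^bold>\<box> (\<^bold>\<box> p \<^bold>\<rightarrow> \<^bold>\<box> \<^bold>\<forall> p) \<^bold>\<rightarrow> \<^bold>\<box> \<^bold>\<forall> p) \<^bold>\<rightarrow> \<^bold>\<box> \<^bold>\<forall> p \<in> ?L"
      using sub[OF ax(3), of "\<lambda>_. p"] by simp
  next
    show "subst \<sigma> (bd DiaM n) \<in> ?L" for \<sigma>
      using sub[OF ax(4)] .
  qed (rule assms)
qed

text \<open>Infinite types make room for the countable factors of the refuting products.\<close>

theorem theorem3p19:
  fixes n :: nat
  assumes "infinite (UNIV :: 'a set)" and "infinite (UNIV :: 'b set)"
    and "n \<ge> 1"
  shows "product_S5 TYPE('a) TYPE('b) (Grz_depth n) = MplusGrzB_depth n"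
proof
  show "MplusGrzB_depth n \<subseteq> product_S5 TYPE('a) TYPE('b) (Grz_depth n)"
    using MplusGrzB_depth_sound by (auto simp: product_S5_def)
  interpret casari_logic "MplusGrzB_depth n" n
    using casari_logic_MplusGrzB_depth[OF assms(3)] .
  show "product_S5 TYPE('a) TYPE('b) (Grz_depth n) \<subseteq> MplusGrzB_depth n"
    using refuted_in_product[OF assms(1,2)] unfolding product_S5_def by blast
qed

end
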